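(* Let $\mathbb{K}$ be a field and let $\mathcal{F}:\mathbb{P}^{r_1}_{\mathbb{K}}\times\mathbb{P}^{r_2}_{\mathbb{K}}\times\cdots\times\mathbb{P}^{r_m}_{\mathbb{K}}\dashrightarrow\mathbb{P}^\delta_{\mathbb{K}}$ be a dominant rational map with $r_1+r_2+\cdots+r_m=\delta$, defined by multi-homogeneous polynomials $f_0,\ldots,f_\delta\in R$ of the same multi-degree $\mathbf{d}$, and let $I=(f_0,\ldots,f_\delta)$. Then $\mathcal{F}$ is birational if and only if for all $n\ge1$ we have $$[I^n]_{n\cdot\mathbf{d}}=\big[(I^n)^{\mathrm{sat}}\big]_{n\cdot\mathbf{d}}.$$
   Context: $R=\mathbb{K}[x_{i,j}\mid 1\le i\le m,\ 0\le j\le r_i]$ is the $\mathbb{Z}^m$-graded polynomial ring (with $x_{i,j}$ of degree the $i$-th unit vector), the multi-homogeneous coordinate ring of $\mathbb{P}^{r_1}\times\cdots\times\mathbb{P}^{r_m}$; $\mathfrak{N}=\bigoplus_{j_1>0,\ldots,j_m>0}R_{j_1,\ldots,j_m}$ is its irrelevant ideal; for an ideal $J\subset R$, $J^{\mathrm{sat}}=(J:\mathfrak{N}^\infty)$; $[M]_{\mathbf c}$ is the component of multi-degree $\mathbf c$. $\mathcal{F}$ is birational if it is dominant with an inverse rational map. *)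

theory Defs
  imports "HOL-Algebra.Ideal_Product" "HOL-Library.Poly_Mapping"
begin

text \<open>
  A monomial is a finitely supported exponent function on the variables \<open>x\<^sub>i\<^sub>,\<^sub>j\<close>, which are
  encoded as pairs \<open>(i, j)\<close>; a polynomial is a finitely supported coefficient function on
  monomials. The library's convolution product is polynomial multiplication. The type has
  infinitely many variables; the ring of interest is cut out by its carrier.
\<close>

type_synonym monom = "(nat \<times> nat) \<Rightarrow>\<^sub>0 nat"
type_synonym 'a mpoly = "monom \<Rightarrow>\<^sub>0 'a"

definition mp_const :: "'a::zero \<Rightarrow> 'a mpoly" where
  "mp_const c = Poly_Mapping.single 0 c"

definition mp_var :: "nat \<times> nat \<Rightarrow> 'a::zero_neq_one mpoly" where
  "mp_var v = Poly_Mapping.single (Poly_Mapping.single v 1) 1"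

definition mp_subst :: "(nat \<times> nat \<Rightarrow> 'a::comm_semiring_1 mpoly) \<Rightarrow> 'a mpoly \<Rightarrow> 'a mpoly" where
  "mp_subst g p =
     (\<Sum>t\<in>Poly_Mapping.keys p. mp_const (Poly_Mapping.lookup p t) *
        (\<Prod>v\<in>Poly_Mapping.keys t. g v ^ Poly_Mapping.lookup t v))"


subsection \<open>The multi-graded coordinate ring\<close>

text \<open>Throughout, \<open>m\<close> and \<open>r\<close> describe \<open>P^(r 1) \<times> ... \<times> P^(r m)\<close>; values of \<open>r\<close> (and of a
  multi-degree) outside \<open>{1..m}\<close> are irrelevant.\<close>

definition mvars :: "nat \<Rightarrow> (nat \<Rightarrow> nat) \<Rightarrow> (nat \<times> nat) set" where
  "mvars m r = (SIGMA i:{1..m}. {0..r i})"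

definition coord_ring :: "nat \<Rightarrow> (nat \<Rightarrow> nat) \<Rightarrow> 'a::field mpoly ring" where
  "coord_ring m r =
     \<lparr> carrier = {p. \<forall>t\<in>Poly_Mapping.keys p. Poly_Mapping.keys t \<subseteq> mvars m r},
       mult = (*), one = 1, zero = 0, add = (+) \<rparr>"

lemma coord_ring_cring: "cring (coord_ring m r :: 'a::field mpoly ring)"
proof (rule cringI)
  show "abelian_group (coord_ring m r :: 'a mpoly ring)"
  proof (rule abelian_groupI)
    fix x y :: "'a mpoly"
    assume "x \<in> carrier (coord_ring m r)" "y \<in> carrier (coord_ring m r)"
    then show "x \<oplus>\<^bsub>coord_ring m r\<^esub> y \<in> carrier (coord_ring m r)"
      using keys_add[of x y] by (fastforce simp: coord_ring_def)
  next
    fix x :: "'a mpoly" assume "x \<in> carrier (coord_ring m r)"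
    then show "\<exists>y\<in>carrier (coord_ring m r). y \<oplus>\<^bsub>coord_ring m r\<^esub> x = \<zero>\<^bsub>coord_ring m r\<^esub>"
      by (intro bexI[of _ "- x"]) (auto simp: coord_ring_def)
  qed (auto simp: coord_ring_def algebra_simps)
  show "Group.comm_monoid (coord_ring m r :: 'a mpoly ring)"
  proof (rule comm_monoidI)
    fix x y :: "'a mpoly"
    assume xy: "x \<in> carrier (coord_ring m r)" "y \<in> carrier (coord_ring m r)"
    show "x \<otimes>\<^bsub>coord_ring m r\<^esub> y \<in> carrier (coord_ring m r)"
      unfolding coord_ring_def
    proof (clarsimp)
      fix t a b assume t: "t \<in> Poly_Mapping.keys (x * y)" and ab: "(a, b) \<in> Poly_Mapping.keys t"
      from t keys_mult[of x y] obtain u v where uv: "t = u + v"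
        "u \<in> Poly_Mapping.keys x" "v \<in> Poly_Mapping.keys y" by blast
      with ab keys_add[of u v] have "(a, b) \<in> Poly_Mapping.keys u \<union> Poly_Mapping.keys v" by blast
      with xy uv show "(a, b) \<in> mvars m r" by (auto simp: coord_ring_def)
    qed
  qed (auto simp: coord_ring_def algebra_simps)
qed (auto simp: coord_ring_def algebra_simps)

definition mdeg :: "(nat \<Rightarrow> nat) \<Rightarrow> monom \<Rightarrow> nat \<Rightarrow> nat" where
  "mdeg r t i = (\<Sum>j=0..r i. Poly_Mapping.lookup t (i, j))"

text \<open>The degree-\<open>c\<close> component of the ring. The grading group is \<open>\<int>^m\<close>, but all components with a
  negative entry vanish, so natural-number degrees suffice.\<close>

definition graded_comp :: "nat \<Rightarrow> (nat \<Rightarrow> nat) \<Rightarrow> (nat \<Rightarrow> nat) \<Rightarrow> 'a::field mpoly set" where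
  "graded_comp m r c =
     {p \<in> carrier (coord_ring m r). \<forall>t\<in>Poly_Mapping.keys p. \<forall>i\<in>{1..m}. mdeg r t i = c i}"

definition ideal_comp ::
  "nat \<Rightarrow> (nat \<Rightarrow> nat) \<Rightarrow> 'a::field mpoly set \<Rightarrow> (nat \<Rightarrow> nat) \<Rightarrow> 'a mpoly set" where
  "ideal_comp m r J c = J \<inter> graded_comp m r c"

definition multihomogeneous :: "nat \<Rightarrow> (nat \<Rightarrow> nat) \<Rightarrow> 'a::field mpoly \<Rightarrow> bool" where
  "multihomogeneous m r p \<longleftrightarrow> (\<exists>c. p \<in> graded_comp m r c)"

definition irrelevant_ideal :: "nat \<Rightarrow> (nat \<Rightarrow> nat) \<Rightarrow> 'a::field mpoly set" where
  "irrelevant_ideal m r =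
     {p \<in> carrier (coord_ring m r). \<forall>t\<in>Poly_Mapping.keys p. \<forall>i\<in>{1..m}. mdeg r t i > 0}"

definition ideal_pow ::
  "nat \<Rightarrow> (nat \<Rightarrow> nat) \<Rightarrow> 'a::field mpoly set \<Rightarrow> nat \<Rightarrow> 'a mpoly set" where
  "ideal_pow m r J n = J [^]\<^bsub>ideals_set (coord_ring m r)\<^esub> n"

definition saturation :: "nat \<Rightarrow> (nat \<Rightarrow> nat) \<Rightarrow> 'a::field mpoly set \<Rightarrow> 'a mpoly set" where
  "saturation m r J =
     {p \<in> carrier (coord_ring m r).
        \<exists>k. \<forall>q\<in>ideal_pow m r (irrelevant_ideal m r) k. q * p \<in> J}"


subsection \<open>Multi-projective space and rational maps\<close>

text \<open>Since the field need not be algebraically closed, multi-projective space is taken to be the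
  scheme: its points are the multi-homogeneous prime ideals not containing the irrelevant ideal.\<close>

definition multiproj :: "nat \<Rightarrow> (nat \<Rightarrow> nat) \<Rightarrow> 'a::field mpoly set set" where
  "multiproj m r =
     {P. primeideal P (coord_ring m r) \<and>
         P = Idl\<^bsub>coord_ring m r\<^esub> {p \<in> P. multihomogeneous m r p} \<and>
         \<not> irrelevant_ideal m r \<subseteq> P}"

definition zariski_closed :: "nat \<Rightarrow> (nat \<Rightarrow> nat) \<Rightarrow> 'a::field mpoly set set \<Rightarrow> bool" where
  "zariski_closed m r Z \<longleftrightarrow>
     (\<exists>T. (\<forall>h\<in>T. multihomogeneous m r h) \<and> Z = {P \<in> multiproj m r. T \<subseteq> P})"

text \<open>A rational map \<open>P^(r 1) \<times> ... \<times> P^(r m) --> P^(s 1) \<times> ... \<times> P^(s k)\<close> is given by representatives: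
  for each target factor \<open>i\<close>, multi-homogeneous forms \<open>g (i, 0), ..., g (i, s i)\<close> of a common
  multi-degree, not all zero.\<close>

definition rational_map ::
  "nat \<Rightarrow> (nat \<Rightarrow> nat) \<Rightarrow> nat \<Rightarrow> (nat \<Rightarrow> nat) \<Rightarrow> (nat \<times> nat \<Rightarrow> 'a::field mpoly) \<Rightarrow> bool" where
  "rational_map m r k s g \<longleftrightarrow>
     (\<forall>i\<in>{1..k}. (\<exists>c. \<forall>j\<in>{0..s i}. g (i, j) \<in> graded_comp m r c) \<and>
                 (\<exists>j\<in>{0..s i}. g (i, j) \<noteq> 0))"

text \<open>Two representatives define the same rational map iff they are proportional in each factor.\<close>

definition same_rational_map ::
  "nat \<Rightarrow> (nat \<Rightarrow> nat) \<Rightarrow> (nat \<times> nat \<Rightarrow> 'a::field mpoly) \<Rightarrow> (nat \<times> nat \<Rightarrow> 'a mpoly) \<Rightarrow> bool" where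
  "same_rational_map k s g h \<longleftrightarrow>
     (\<forall>i\<in>{1..k}. \<forall>j\<in>{0..s i}. \<forall>l\<in>{0..s i}. g (i, j) * h (i, l) = g (i, l) * h (i, j))"

definition map_domain ::
  "nat \<Rightarrow> (nat \<Rightarrow> nat) \<Rightarrow> nat \<Rightarrow> (nat \<Rightarrow> nat) \<Rightarrow> (nat \<times> nat \<Rightarrow> 'a::field mpoly) \<Rightarrow> 'a mpoly set set" where
  "map_domain m r k s g = {P \<in> multiproj m r. \<forall>i\<in>{1..k}. \<exists>j\<in>{0..s i}. g (i, j) \<notin> P}"

text \<open>The image of a point \<open>P\<close>: the prime generated by the multi-homogeneous forms on the target whose
  pullback lies in \<open>P\<close>.\<close>

definition map_point ::
  "nat \<Rightarrow> (nat \<Rightarrow> nat) \<Rightarrow> (nat \<times> nat \<Rightarrow> 'a::field mpoly) \<Rightarrow> 'a mpoly set \<Rightarrow> 'a mpoly set" where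
  "map_point k s g P =
     Idl\<^bsub>coord_ring k s\<^esub> {h. multihomogeneous k s h \<and> mp_subst g h \<in> P}"

text \<open>Dominance (dense image) is tested on the open set where the given representative is defined;
  on an irreducible source this does not depend on the choice of the representative.\<close>

definition dominant ::
  "nat \<Rightarrow> (nat \<Rightarrow> nat) \<Rightarrow> nat \<Rightarrow> (nat \<Rightarrow> nat) \<Rightarrow> (nat \<times> nat \<Rightarrow> 'a::field mpoly) \<Rightarrow> bool" where
  "dominant m r k s g \<longleftrightarrow>
     (\<forall>Z. zariski_closed k s Z \<and> map_point k s g ` map_domain m r k s g \<subseteq> Z
          \<longrightarrow> Z = multiproj k s)"

text \<open>The family \<open>mp_var\<close> represents the identity, and \<open>\<lambda>v. mp_subst f (g v)\<close> represents the
  composite \<open>g \<circ> f\<close>; requiring it to be a \<open>rational_map\<close> says that the composite is defined.\<close>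

definition birational ::
  "nat \<Rightarrow> (nat \<Rightarrow> nat) \<Rightarrow> nat \<Rightarrow> (nat \<Rightarrow> nat) \<Rightarrow> (nat \<times> nat \<Rightarrow> 'a::field mpoly) \<Rightarrow> bool" where
  "birational m r k s f \<longleftrightarrow>
     rational_map m r k s f \<and> dominant m r k s f \<and>
     (\<exists>g. rational_map k s m r g \<and>
          rational_map m r m r (\<lambda>v. mp_subst f (g v)) \<and>
          same_rational_map m r (\<lambda>v. mp_subst f (g v)) mp_var \<and>
          rational_map k s k s (\<lambda>v. mp_subst g (f v)) \<and>
          same_rational_map k s (\<lambda>v. mp_subst g (f v)) mp_var)"

text \<open>Projective space \<open>P^\<delta>\<close> is the case of a single factor; its coordinates are the \<open>(1, j)\<close>, and the
  tuple \<open>(f\<^sub>0 : ... : f\<^sub>\<delta>)\<close> becomes the following family.\<close>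

definition to_proj :: "(nat \<Rightarrow> 'a mpoly) \<Rightarrow> nat \<times> nat \<Rightarrow> 'a mpoly" where
  "to_proj f = (\<lambda>(i, j). f j)"

end

theory Submission
  imports Defs "HOL-Library.Product_Lexorder" "HOL.Vector_Spaces"
begin

text \<open>
  Write \<open>\<phi>\<close> for the pullback of forms along the map, \<open>A\<close> for the image of \<open>\<phi>\<close>, and \<open>A\<^sub>n\<close> for the pulled
  back forms of degree \<open>n\<close>. Since the base ideal is generated in degree \<open>d\<close>, the degree \<open>nd\<close> part of
  its \<open>n\<close>-th power is \<open>A\<^sub>n\<close> (\<open>ideal_comp_pow_eq_pullbacks\<close>). Dominance says that no nonzero form is
  pulled back to zero (\<open>dominant_imp_graded_injective\<close>), so identities between pulled back forms can be
  read in a polynomial ring in \<open>\<delta> + 1\<close> variables. Birationality means that every ratio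
  \<open>x\<^sub>i\<^sub>,\<^sub>j / x\<^sub>i\<^sub>,\<^sub>0\<close> is a quotient of two elements of some \<open>A\<^sub>N\<close>. The link between the two sides is an elementary description of the saturation in terms of
  the graded pieces \<open>R\<^sub>c\<close> of the coordinate ring: an element \<open>h\<close> of degree \<open>nd\<close> lies in the saturation
  of the \<open>n\<close>-th power if and only if \<open>h R\<^sub>c \<subseteq> R\<^sub>c A\<^sub>n\<close> for some \<open>c\<close>, that is, if \<open>h\<close> acts on the finitely
  generated \<open>A\<close>-module \<open>R\<^sub>c A\<close> (\<open>saturation_multiplier\<close>, \<open>multiplier_in_saturation\<close>).

  Suppose that the map is birational, and let \<open>h\<close> be such an element. By birationality \<open>h\<close> is a quotient
  \<open>\<alpha> / \<beta>\<close> of elements of \<open>A\<close>, and \<open>R\<^sub>c A\<close> has rank one, so that some nonzero \<open>\<epsilon> \<in> A\<close> carries it into a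
  free module of rank one. Iterating the action of \<open>h\<close> gives \<open>\<epsilon> h\<^sup>s \<in> A\<close> for all \<open>s\<close>. Polynomial rings are
  completely integrally closed, hence \<open>h \<in> A\<close>. The last fact is proved by division with respect to a
  monomial order (\<open>almost_integral_quotient\<close>): the divisibilities \<open>\<beta>\<^sup>s dvd \<epsilon> \<alpha>\<^sup>s\<close> force the leading
  monomial of \<open>\<beta>\<close> to divide that of \<open>\<alpha>\<close>, and they survive a division step.

  Conversely, suppose that the powers are saturated in the relevant degrees. The hypothesis
  \<open>r\<^sub>1 + \<dots> + r\<^sub>m = \<delta>\<close> enters through growth rates: \<open>dim A\<^sub>n\<close> grows like \<open>n\<^sup>\<delta>\<close> and \<open>dim R\<^bsub>c + nd\<^esub>\<close> grows at most like
  \<open>n\<^sup>\<delta>\<close>, with a constant independent of \<open>c\<close>, so the ranks of the modules \<open>R\<^sub>c A\<close> are bounded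
  (\<open>independent_bound\<close>). This count takes the place of an argument by transcendence degree. If \<open>c\<close> is chosen with maximal
  rank, multiplication by \<open>x\<^sub>i\<^sub>,\<^sub>0\<close> maps \<open>R\<^sub>c A\<close> onto a submodule of full rank in the next piece; hence there is
  a nonzero \<open>a \<in> A\<^sub>N\<close> with \<open>a x\<^sub>i\<^sub>,\<^sub>j R\<^sub>c \<subseteq> x\<^sub>i\<^sub>,\<^sub>0 R\<^sub>c A\<^sub>N\<close>. Then \<open>a x\<^sub>i\<^sub>,\<^sub>j / x\<^sub>i\<^sub>,\<^sub>0\<close> is a polynomial, acts on \<open>R\<^sub>c A\<close>, and
  therefore lies in \<open>A\<^sub>N\<close> by saturation, which writes \<open>x\<^sub>i\<^sub>,\<^sub>j / x\<^sub>i\<^sub>,\<^sub>0\<close> as a quotient of two elements of \<open>A\<^sub>N\<close>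
  (\<open>saturated_imp_proportional\<close>). These quotients are the components of the inverse map.
\<close>

section \<open>Polynomials and substitution\<close>

abbreviation (input) "lookup \<equiv> Poly_Mapping.lookup"
abbreviation (input) "keys \<equiv> Poly_Mapping.keys"
abbreviation (input) "single \<equiv> Poly_Mapping.single"

lemma poly_mapping_eq_sum_single:
  fixes p :: "'b \<Rightarrow>\<^sub>0 'c::comm_monoid_add"
  assumes "finite A" "keys p \<subseteq> A"
  shows "p = (\<Sum>t\<in>A. single t (lookup p t))"
proof (rule poly_mapping_eqI)
  fix u
  have "lookup (\<Sum>t\<in>A. single t (lookup p t)) u = (\<Sum>t\<in>A. if t = u then lookup p t else 0)"
    by (auto simp: lookup_sum lookup_single when_def intro!: sum.cong)
  also have "\<dots> = lookup p u"
    using assms by (auto simp: in_keys_iff)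
  finally show "lookup p u = lookup (\<Sum>t\<in>A. single t (lookup p t)) u" by simp
qed

text \<open>
  The form in which all linearity arguments below are run: an additive property of polynomials with
  support in \<open>M\<close> has to be checked on terms only.
\<close>
lemma mpoly_induct_keys [consumes 1, case_names zero single add]:
  fixes p :: "'b \<Rightarrow>\<^sub>0 'c::comm_monoid_add"
  assumes "keys p \<subseteq> M" "P 0" "\<And>t a. t \<in> M \<Longrightarrow> P (single t a)"
    "\<And>p q. keys p \<subseteq> M \<Longrightarrow> keys q \<subseteq> M \<Longrightarrow> P p \<Longrightarrow> P q \<Longrightarrow> P (p + q)"
  shows "P p"
proof -
  have "keys (\<Sum>t\<in>A. single t (lookup p t)) \<subseteq> M \<and> P (\<Sum>t\<in>A. single t (lookup p t))"
    if "finite A" "A \<subseteq> M" for A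
    using that
  proof (induction A rule: finite_induct)
    case (insert x F)
    have "keys (single x (lookup p x) + (\<Sum>t\<in>F. single t (lookup p t))) \<subseteq> M"
      using keys_add[of "single x (lookup p x)" "\<Sum>t\<in>F. single t (lookup p t)"] insert
      by (auto split: if_splits)
    moreover have "P (single x (lookup p x) + (\<Sum>t\<in>F. single t (lookup p t)))"
      using insert by (intro assms(3,4)) auto
    ultimately show ?case using insert by simp
  qed (auto simp: assms)
  from conjunct2[OF this[OF finite_keys assms(1)]]
  have "P (\<Sum>t\<in>keys p. single t (lookup p t))" .
  moreover have "P (\<Sum>t\<in>keys p. single t (lookup p t)) = P p"
    by (intro arg_cong[where f = P] poly_mapping_eq_sum_single[symmetric]) auto
  ultimately show ?thesis by blast
qed

definition mon_subst :: "(nat \<times> nat \<Rightarrow> 'a::comm_semiring_1 mpoly) \<Rightarrow> monom \<Rightarrow> 'a mpoly" where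
  "mon_subst g t = (\<Prod>v\<in>keys t. g v ^ lookup t v)"

lemma mon_subst_superset:
  "finite V \<Longrightarrow> keys t \<subseteq> V \<Longrightarrow> mon_subst g t = (\<Prod>v\<in>V. g v ^ lookup t v)"
  unfolding mon_subst_def by (rule prod.mono_neutral_left) (auto simp: in_keys_iff)

lemma mon_subst_0 [simp]: "mon_subst g 0 = 1"
  by (simp add: mon_subst_def)

lemma mon_subst_add: "mon_subst g (t + u) = mon_subst g t * mon_subst g u"
proof -
  let ?V = "keys t \<union> keys u"
  have "mon_subst g (t + u) = (\<Prod>v\<in>?V. g v ^ lookup (t + u) v)"
    using keys_add[of t u] by (intro mon_subst_superset) auto
  also have "\<dots> = (\<Prod>v\<in>?V. g v ^ lookup t v) * (\<Prod>v\<in>?V. g v ^ lookup u v)"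
    by (simp add: lookup_add power_add prod.distrib)
  finally show ?thesis by (simp add: mon_subst_superset[of ?V])
qed

lemma mon_subst_single [simp]: "mon_subst g (single v n) = g v ^ n"
  by (cases "n = 0") (auto simp: mon_subst_def)

lemma mp_const_0 [simp]: "mp_const 0 = 0"
  and mp_const_1 [simp]: "mp_const 1 = 1"
  and mp_const_add: "mp_const (a + b) = mp_const a + mp_const b"
  by (simp_all add: mp_const_def single_add)

lemma mp_const_mult: "mp_const (a * b) = mp_const a * (mp_const b :: 'a::comm_semiring_1 mpoly)"
  by (simp add: mp_const_def mult_single)

lemma mp_const_mult_single [simp]: "mp_const c * single t a = single t (c * a :: 'a::comm_semiring_1)"
  by (simp add: mp_const_def mult_single)

lemma mp_subst_superset:
  assumes "finite A" "keys p \<subseteq> A"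
  shows "mp_subst g p = (\<Sum>t\<in>A. mp_const (lookup p t) * mon_subst g t)"
  unfolding mp_subst_def mon_subst_def[symmetric] using assms
  by (intro sum.mono_neutral_left) (auto simp: in_keys_iff)

lemma mp_subst_0 [simp]: "mp_subst g 0 = 0"
  by (simp add: mp_subst_def)

lemma mp_subst_single [simp]: "mp_subst g (single t c) = mp_const c * mon_subst g t"
  by (subst mp_subst_superset[of "{t}"]) auto

lemma mp_subst_add: "mp_subst g (p + q) = mp_subst g p + mp_subst g q"
proof -
  let ?A = "keys p \<union> keys q"
  have "mp_subst g (p + q) = (\<Sum>t\<in>?A. mp_const (lookup (p + q) t) * mon_subst g t)"
    using keys_add[of p q] by (intro mp_subst_superset) auto
  then show ?thesis
    by (simp add: lookup_add mp_const_add algebra_simps sum.distrib mp_subst_superset[of ?A])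
qed

lemma mp_subst_mult: "mp_subst g (p * q) = mp_subst g p * mp_subst g q"
proof -
  have single: "mp_subst g (single t a * q) = mp_subst g (single t a) * mp_subst g q" for t a
  proof -
    have "keys q \<subseteq> UNIV" by simp
    then show ?thesis
      by (induction q rule: mpoly_induct_keys)
         (auto simp: mult_single mon_subst_add mp_const_mult mp_subst_add algebra_simps)
  qed
  have "keys p \<subseteq> UNIV" by simp
  then show ?thesis
    by (induction p rule: mpoly_induct_keys) (simp_all add: single distrib_right mp_subst_add del: mp_subst_single)
qed

lemma mp_subst_1 [simp]: "mp_subst g 1 = 1"
  using mp_subst_single[of g 0 1] by (simp del: mp_subst_single)

lemma mp_subst_const [simp]: "mp_subst g (mp_const c) = mp_const c"
  by (simp add: mp_const_def)

lemma mp_subst_var [simp]: "mp_subst g (mp_var v) = g v"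
  by (simp add: mp_var_def)

lemma mp_subst_power: "mp_subst g (p ^ n) = mp_subst g p ^ n"
  by (induction n) (simp_all add: mp_subst_mult)

lemma mp_subst_sum: "mp_subst g (sum h A) = (\<Sum>x\<in>A. mp_subst g (h x))"
  by (induction A rule: infinite_finite_induct) (simp_all add: mp_subst_add)

lemma mp_subst_prod: "mp_subst g (prod h A) = (\<Prod>x\<in>A. mp_subst g (h x))"
  by (induction A rule: infinite_finite_induct) (simp_all add: mp_subst_mult)

lemma mp_subst_uminus: "mp_subst g (- p) = - mp_subst g (p :: 'a::comm_ring_1 mpoly)"
  using mp_subst_add[of g p "- p"] by (simp add: eq_neg_iff_add_eq_0 add.commute)

lemma mp_subst_diff: "mp_subst g (p - q) = mp_subst g p - mp_subst g (q :: 'a::comm_ring_1 mpoly)"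
  using mp_subst_add[of g p "- q"] by (simp add: mp_subst_uminus)

text \<open>
  The map \<open>mp_subst g\<close> is a ring homomorphism fixing the constants, so composites of substitutions are
  determined by the images of the variables. This identifies a composite of rational maps with a
  substitution.
\<close>
lemma mp_subst_mp_subst: "mp_subst f (mp_subst g p) = mp_subst (\<lambda>v. mp_subst f (g v)) p"
  unfolding mp_subst_def[of g] mp_subst_def[of "\<lambda>v. mp_subst f (g v)"]
  by (simp add: mp_subst_sum mp_subst_mult mp_subst_prod mp_subst_power)

section \<open>The multigrading\<close>

definition monoms :: "nat \<Rightarrow> (nat \<Rightarrow> nat) \<Rightarrow> (nat \<Rightarrow> nat) \<Rightarrow> monom set" where
  "monoms m r c = {t. keys t \<subseteq> mvars m r \<and> (\<forall>i\<in>{1..m}. mdeg r t i = c i)}"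

abbreviation cring_carrier :: "nat \<Rightarrow> (nat \<Rightarrow> nat) \<Rightarrow> 'a::field mpoly set" where
  "cring_carrier m r \<equiv> carrier (coord_ring m r)"

lemma coord_ring_simps [simp]:
  "mult (coord_ring m r) = (*)" "add (coord_ring m r) = (+)"
  "one (coord_ring m r) = 1" "zero (coord_ring m r) = 0"
  by (simp_all add: coord_ring_def)

lemma carrier_iff: "p \<in> cring_carrier m r \<longleftrightarrow> keys p \<subseteq> {t. keys t \<subseteq> mvars m r}"
  by (auto simp: coord_ring_def)

lemma graded_comp_iff: "p \<in> graded_comp m r c \<longleftrightarrow> keys p \<subseteq> monoms m r c"
  by (auto simp: graded_comp_def carrier_iff monoms_def)

lemma finite_mvars [simp]: "finite (mvars m r)"
  by (simp add: mvars_def)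

lemma mdeg_add: "mdeg r (t + u) i = mdeg r t i + mdeg r u i"
  by (simp add: mdeg_def lookup_add sum.distrib)

lemma mdeg_0 [simp]: "mdeg r 0 i = 0"
  by (simp add: mdeg_def)

lemma monoms_add: "t \<in> monoms m r c \<Longrightarrow> u \<in> monoms m r e \<Longrightarrow> t + u \<in> monoms m r (\<lambda>i. c i + e i)"
  using keys_add[of t u] by (auto simp: monoms_def mdeg_add)

lemma monoms_cong: "(\<And>i. i \<in> {1..m} \<Longrightarrow> c i = e i) \<Longrightarrow> monoms m r c = monoms m r e"
  by (auto simp: monoms_def)

lemma graded_comp_cong: "(\<And>i. i \<in> {1..m} \<Longrightarrow> c i = e i) \<Longrightarrow> graded_comp m r c = graded_comp m r e"
  using monoms_cong[of m c e] by (auto simp: graded_comp_iff)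

lemma graded_comp_0 [simp]: "0 \<in> graded_comp m r c"
  by (simp add: graded_comp_iff)

lemma graded_comp_add: "p \<in> graded_comp m r c \<Longrightarrow> q \<in> graded_comp m r c \<Longrightarrow> p + q \<in> graded_comp m r c"
  using keys_add[of p q] by (auto simp: graded_comp_iff)

lemma graded_comp_sum: "(\<And>x. x \<in> A \<Longrightarrow> h x \<in> graded_comp m r c) \<Longrightarrow> sum h A \<in> graded_comp m r c"
  by (induction A rule: infinite_finite_induct) (auto intro: graded_comp_add)

lemma graded_comp_uminus: "p \<in> graded_comp m r c \<Longrightarrow> - p \<in> graded_comp m r c"
  by (auto simp: graded_comp_iff in_keys_iff)

lemma graded_comp_diff: "p \<in> graded_comp m r c \<Longrightarrow> q \<in> graded_comp m r c \<Longrightarrow> p - q \<in> graded_comp m r c"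
  using graded_comp_add[of p m r c "- q"] by (simp add: graded_comp_uminus)

lemma graded_comp_mult:
  "p \<in> graded_comp m r c \<Longrightarrow> q \<in> graded_comp m r e \<Longrightarrow> p * q \<in> graded_comp m r (\<lambda>i. c i + e i)"
  using keys_mult[of p q] monoms_add[of _ m r c _ e] by (fastforce simp: graded_comp_iff)

lemma graded_comp_single: "t \<in> monoms m r c \<Longrightarrow> single t a \<in> graded_comp m r c"
  by (auto simp: graded_comp_iff)

lemma monoms_0: "0 \<in> monoms m r (\<lambda>_. 0)"
  by (simp add: monoms_def)

lemma graded_comp_const: "mp_const a \<in> graded_comp m r (\<lambda>_. 0)"
  using graded_comp_single[OF monoms_0] by (simp add: mp_const_def)

lemma graded_comp_1: "1 \<in> graded_comp m r (\<lambda>_. 0)"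
  using graded_comp_const[of 1] by simp

lemma graded_comp_const_mult: "p \<in> graded_comp m r c \<Longrightarrow> mp_const a * p \<in> graded_comp m r c"
  using graded_comp_mult[OF graded_comp_const, of p m r c] by simp

lemma graded_comp_power:
  "p \<in> graded_comp m r c \<Longrightarrow> p ^ n \<in> graded_comp m r (\<lambda>i. n * c i)"
  by (induction n) (auto simp: graded_comp_1 dest: graded_comp_mult)

lemma graded_comp_prod:
  "(\<And>x. x \<in> A \<Longrightarrow> h x \<in> graded_comp m r (c x)) \<Longrightarrow> prod h A \<in> graded_comp m r (\<lambda>i. \<Sum>x\<in>A. c x i)"
proof (induction A rule: infinite_finite_induct)
  case (insert x F)
  then show ?case using graded_comp_mult[of "h x" m r "c x" "prod h F" "\<lambda>i. \<Sum>x\<in>F. c x i"] by simp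
qed (auto simp: graded_comp_1)

lemma graded_comp_carrier: "p \<in> graded_comp m r c \<Longrightarrow> p \<in> cring_carrier m r"
  by (simp add: graded_comp_def)

lemma carrier_add: "p \<in> cring_carrier m r \<Longrightarrow> q \<in> cring_carrier m r \<Longrightarrow> p + q \<in> cring_carrier m r"
  using keys_add[of p q] by (fastforce simp: carrier_iff)

lemma carrier_mult: "p \<in> cring_carrier m r \<Longrightarrow> q \<in> cring_carrier m r \<Longrightarrow> p * q \<in> cring_carrier m r"
  using cring.cring_simprules(5)[OF coord_ring_cring, of p m r q] by simp

lemma mdeg_single_var:
  "mdeg r (single (i, j) n) k = (if k = i \<and> j \<le> r i then n else 0)"
  by (auto simp: mdeg_def lookup_single when_def)

lemma monoms_var: "v \<in> mvars m r \<Longrightarrow> single v 1 \<in> monoms m r (\<lambda>k. if k = fst v then 1 else 0)"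
  by (cases v) (auto simp: monoms_def mvars_def mdeg_single_var)

lemma graded_comp_var: "v \<in> mvars m r \<Longrightarrow> mp_var v \<in> graded_comp m r (\<lambda>k. if k = fst v then 1 else 0)"
  unfolding mp_var_def by (intro graded_comp_single monoms_var)

lemma zeroth_coordinates_product:
  "(\<Prod>i=1..m. mp_var (i, 0)) \<in> (graded_comp m r (\<lambda>_. 1) :: 'a::field mpoly set)"
proof -
  have "(\<Prod>i=1..m. mp_var (i, 0)) \<in> graded_comp m r (\<lambda>l. \<Sum>i=1..m. if l = fst (i, 0::nat) then 1 else 0)"
    by (intro graded_comp_prod graded_comp_var) (auto simp: mvars_def)
  also have "graded_comp m r (\<lambda>l. \<Sum>i=1..m. if l = fst (i, 0::nat) then 1 else 0) = graded_comp m r (\<lambda>_. 1)"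
    by (rule graded_comp_cong) auto
  finally show ?thesis .
qed

lemma mp_var_nonzero [simp]: "mp_var v \<noteq> (0 :: 'a::zero_neq_one mpoly)"
  by (metis lookup_single_eq lookup_zero mp_var_def zero_neq_one)

lemma sum_mvars: "sum h (mvars m r) = (\<Sum>i=1..m. \<Sum>j=0..r i. h (i, j))"
  by (simp add: mvars_def sum.Sigma)

lemma prod_mvars: "prod h (mvars m r) = (\<Prod>i=1..m. \<Prod>j=0..r i. h (i, j))"
  by (simp add: mvars_def prod.Sigma)

text \<open>
  A monomial of degree \<open>c\<close> has \<open>c i\<close> factors from the \<open>i\<close>-th group of variables, each of which
  contributes the degree \<open>\<gamma> i\<close>.
\<close>
lemma mp_subst_graded:
  fixes g :: "nat \<times> nat \<Rightarrow> 'a::field mpoly"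
  assumes g: "\<And>i j. i \<in> {1..m} \<Longrightarrow> j \<le> r i \<Longrightarrow> g (i, j) \<in> graded_comp k s (\<gamma> i)"
    and p: "p \<in> graded_comp m r c"
  shows "mp_subst g p \<in> graded_comp k s (\<lambda>l. \<Sum>i=1..m. c i * \<gamma> i l)"
proof -
  have mon: "mon_subst g t \<in> graded_comp k s (\<lambda>l. \<Sum>i=1..m. c i * \<gamma> i l)" if t: "t \<in> monoms m r c" for t
  proof -
    have "mon_subst g t = (\<Prod>v\<in>mvars m r. g v ^ lookup t v)"
      using t by (intro mon_subst_superset) (auto simp: monoms_def)
    moreover have "(\<Prod>v\<in>mvars m r. g v ^ lookup t v) \<in> graded_comp k s (\<lambda>l. \<Sum>v\<in>mvars m r. lookup t v * \<gamma> (fst v) l)"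
      by (intro graded_comp_prod graded_comp_power) (auto simp: mvars_def intro!: g)
    moreover have "(\<Sum>v\<in>mvars m r. lookup t v * \<gamma> (fst v) l) = (\<Sum>i=1..m. c i * \<gamma> i l)" for l
      using t by (auto simp: sum_mvars monoms_def mdeg_def sum_distrib_right[symmetric] intro!: sum.cong)
    ultimately show ?thesis by simp
  qed
  from p have "keys p \<subseteq> monoms m r c" by (simp add: graded_comp_iff)
  then show ?thesis
    by (induction p rule: mpoly_induct_keys)
       (auto simp: mp_subst_add intro!: graded_comp_add graded_comp_const_mult dest: mon)
qed

lemma finite_monoms [simp]: "finite (monoms m r c)"
proof -
  let ?F = "{h. \<forall>v. (v \<in> mvars m r \<longrightarrow> h v \<in> {0..Max (c ` {1..m})}) \<and> (v \<notin> mvars m r \<longrightarrow> h v = 0)}"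
  have "finite ?F" by (rule finite_set_of_finite_funs) auto
  moreover have "lookup ` monoms m r c \<subseteq> ?F"
  proof (clarsimp, intro conjI impI allI)
    fix t i j assume t: "t \<in> monoms m r c"
    { assume v: "(i, j) \<in> mvars m r"
      have "lookup t (i, j) \<le> mdeg r t i" using v unfolding mdeg_def mvars_def by (intro member_le_sum) auto
      also have "\<dots> = c i" using t v by (auto simp: monoms_def mvars_def)
      also have "\<dots> \<le> Max (c ` {1..m})" using v by (auto simp: mvars_def intro!: Max_ge)
      finally show "lookup t (i, j) \<le> Max (c ` {Suc 0..m})" by simp }
    { assume "(i, j) \<notin> mvars m r" with t show "lookup t (i, j) = 0" by (auto simp: monoms_def in_keys_iff) }
  qed
  ultimately have "finite (lookup ` monoms m r c)" by (rule finite_subset[rotated])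
  moreover have "inj_on lookup (monoms m r c)" by (rule inj_onI, rule poly_mapping_eqI) simp
  ultimately show ?thesis by (rule finite_imageD)
qed

section \<open>Homogeneous components\<close>

definition hcomp :: "nat \<Rightarrow> (nat \<Rightarrow> nat) \<Rightarrow> (nat \<Rightarrow> nat) \<Rightarrow> 'a::field mpoly \<Rightarrow> 'a mpoly" where
  "hcomp m r c p = (\<Sum>t\<in>{t \<in> keys p. \<forall>i\<in>{1..m}. mdeg r t i = c i}. single t (lookup p t))"

lemma lookup_hcomp:
  "lookup (hcomp m r c p) t = (if \<forall>i\<in>{1..m}. mdeg r t i = c i then lookup p t else 0)"
proof -
  have "lookup (hcomp m r c p) t
      = (\<Sum>u\<in>{t \<in> keys p. \<forall>i\<in>{1..m}. mdeg r t i = c i}. if u = t then lookup p u else 0)"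
    unfolding hcomp_def by (auto simp: lookup_sum lookup_single when_def intro!: sum.cong)
  also have "\<dots> = (if \<forall>i\<in>{1..m}. mdeg r t i = c i then lookup p t else 0)"
    by (subst sum.delta) (auto simp: in_keys_iff)
  finally show ?thesis .
qed

lemma hcomp_0 [simp]: "hcomp m r c 0 = 0"
  by (simp add: hcomp_def)

lemma hcomp_add: "hcomp m r c (p + q) = hcomp m r c p + hcomp m r c q"
  by (rule poly_mapping_eqI) (simp add: lookup_hcomp lookup_add)

lemma hcomp_sum: "hcomp m r c (sum h A) = (\<Sum>x\<in>A. hcomp m r c (h x))"
  by (induction A rule: infinite_finite_induct) (auto simp: hcomp_add)

lemma hcomp_graded: "p \<in> cring_carrier m r \<Longrightarrow> hcomp m r c p \<in> graded_comp m r c"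
  by (auto simp: graded_comp_iff carrier_iff monoms_def in_keys_iff lookup_hcomp split: if_splits)

lemma hcomp_id: "p \<in> graded_comp m r c \<Longrightarrow> hcomp m r c p = p"
  by (rule poly_mapping_eqI) (auto simp: lookup_hcomp graded_comp_def in_keys_iff)

lemma hcomp_other:
  assumes "p \<in> graded_comp m r e" "i \<in> {1..m}" "e i \<noteq> c i"
  shows "hcomp m r c p = 0"
proof (rule poly_mapping_eqI)
  fix t
  have "mdeg r t i = e i" if "lookup p t \<noteq> 0"
    using assms(1,2) that by (simp add: graded_comp_def in_keys_iff)
  with assms(2,3) show "lookup (hcomp m r c p) t = lookup 0 t"
    by (cases "lookup p t = 0") (auto simp: lookup_hcomp intro!: bexI[of _ i])
qed

lemma hcomp_single:
  "hcomp m r c (single t a) = (if \<forall>i\<in>{1..m}. mdeg r t i = c i then single t a else 0)"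
  by (rule poly_mapping_eqI) (auto simp: lookup_hcomp lookup_single when_def)

lemma hcomp_mult_graded:
  assumes "q \<in> graded_comp m r e"
  shows "hcomp m r (\<lambda>i. c i + e i) (p * q) = hcomp m r c p * q"
proof -
  have single: "hcomp m r (\<lambda>i. c i + e i) (single t a * q) = hcomp m r c (single t a) * q" for t a
  proof -
    have "keys q \<subseteq> monoms m r e" using assms by (simp add: graded_comp_iff)
    then show ?thesis
    proof (induction q rule: mpoly_induct_keys)
      case (single u b)
      then have "(\<forall>i\<in>{1..m}. mdeg r (t + u) i = c i + e i) \<longleftrightarrow> (\<forall>i\<in>{1..m}. mdeg r t i = c i)"
        by (auto simp: mdeg_add monoms_def)
      then show ?case by (simp add: mult_single hcomp_single)
    qed (auto simp: hcomp_add distrib_left)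
  qed
  have "keys p \<subseteq> UNIV" by simp
  then show ?thesis
    by (induction p rule: mpoly_induct_keys) (simp_all add: hcomp_add single distrib_right)
qed

section \<open>Additive spans\<close>

text \<open>
  Closure under scalars is left out because the generating sets in use have it themselves.
\<close>
inductive_set add_span :: "'b::comm_monoid_add set \<Rightarrow> 'b set" for G where
  zero: "0 \<in> add_span G"
| step: "g \<in> G \<Longrightarrow> x \<in> add_span G \<Longrightarrow> g + x \<in> add_span G"

lemma add_span_base: "g \<in> G \<Longrightarrow> g \<in> add_span G"
  using add_span.step[OF _ add_span.zero] by fastforce

lemma add_span_add: "x \<in> add_span G \<Longrightarrow> y \<in> add_span G \<Longrightarrow> x + y \<in> add_span G"
  by (induction rule: add_span.induct) (auto simp: add.assoc intro: add_span.step)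

lemma add_span_sum: "(\<And>a. a \<in> A \<Longrightarrow> h a \<in> add_span G) \<Longrightarrow> sum h A \<in> add_span G"
  by (induction A rule: infinite_finite_induct) (auto intro: add_span_add add_span.zero)

lemma add_span_mono:
  assumes "x \<in> add_span G" "G \<subseteq> H"
  shows "x \<in> add_span H"
  using assms by (induction rule: add_span.induct) (auto intro: add_span.intros)

lemma add_span_image:
  assumes "x \<in> add_span G" "h 0 = 0" "\<And>x y. h (x + y) = h x + h y" "\<And>g. g \<in> G \<Longrightarrow> h g \<in> add_span H"
  shows "h x \<in> add_span H"
  using assms(1) by (induction rule: add_span.induct) (auto simp: assms intro: add_span.zero add_span_add)

lemma add_span_mult:
  fixes x y :: "'b::comm_semiring_0"
  assumes "x \<in> add_span G" "y \<in> add_span H" "\<And>g h. g \<in> G \<Longrightarrow> h \<in> H \<Longrightarrow> g * h \<in> add_span K"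
  shows "x * y \<in> add_span K"
proof (rule add_span_image[OF assms(1), of "\<lambda>x. x * y"])
  fix g assume "g \<in> G"
  then show "g * y \<in> add_span K"
    by (intro add_span_image[OF assms(2), of "\<lambda>y. g * y"] assms(3)) (auto simp: distrib_left)
qed (auto simp: distrib_right)

section \<open>Ideals of the coordinate ring\<close>

text \<open>
  Additive inverses are multiples by the constant \<open>-1\<close>, so the group axioms reduce to closure under sums.
\<close>
lemma coord_ideal_iff:
  "ideal J (coord_ring m r) \<longleftrightarrow> J \<subseteq> cring_carrier m r \<and> 0 \<in> J \<and> (\<forall>x\<in>J. \<forall>y\<in>J. x + y \<in> J) \<and>
     (\<forall>p\<in>cring_carrier m r. \<forall>x\<in>J. p * x \<in> J)" (is "_ \<longleftrightarrow> ?rhs")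
proof
  assume J: "ideal J (coord_ring m r)"
  interpret ideal J "coord_ring m r" by fact
  show ?rhs
    using a_subset additive_subgroup.zero_closed[OF additive_subgroup_axioms]
      additive_subgroup.a_closed[OF additive_subgroup_axioms] I_l_closed by auto
next
  assume J: ?rhs
  interpret cring "coord_ring m r :: 'a mpoly ring" by (rule coord_ring_cring)
  have neg: "\<ominus>\<^bsub>coord_ring m r\<^esub> x = (- 1) * x" "(- 1) * x \<in> J" if "x \<in> J" for x
  proof -
    have "- 1 \<in> cring_carrier m r"
      by (rule graded_comp_carrier[OF graded_comp_uminus[OF graded_comp_1]])
    with J that show *: "(- 1) * x \<in> J" by blast
    with J that have "x \<in> cring_carrier m r" "(- 1) * x \<in> cring_carrier m r" by auto
    then show "\<ominus>\<^bsub>coord_ring m r\<^esub> x = (- 1) * x"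
      using minus_equality[of "(- 1) * x" x] by simp
  qed
  show "ideal J (coord_ring m r)"
  proof (rule idealI)
    show "ring (coord_ring m r :: 'a mpoly ring)" by (rule ring_axioms)
    show "subgroup J (add_monoid (coord_ring m r))"
    proof (rule subgroup.intro)
      fix x assume "x \<in> J"
      then show "inv\<^bsub>add_monoid (coord_ring m r)\<^esub> x \<in> J"
        using neg[of x] unfolding a_inv_def by simp
    qed (use J in auto)
  next
    fix a x :: "'a mpoly"
    assume "a \<in> J" "x \<in> cring_carrier m r"
    then show "x \<otimes>\<^bsub>coord_ring m r\<^esub> a \<in> J" "a \<otimes>\<^bsub>coord_ring m r\<^esub> x \<in> J"
      using J by (auto simp: mult.commute[of a x])
  qed
qed

lemma ideal_uminus:
  assumes "ideal J (coord_ring m r)" "x \<in> J"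
  shows "- x \<in> J"
proof -
  have "- 1 \<in> cring_carrier m r"
    by (rule graded_comp_carrier[OF graded_comp_uminus[OF graded_comp_1]])
  with assms have "(- 1) * x \<in> J" unfolding coord_ideal_iff by blast
  then show ?thesis by simp
qed

lemma ideal_sum:
  assumes "ideal J (coord_ring m r)" "\<And>a. a \<in> A \<Longrightarrow> h a \<in> J"
  shows "sum h A \<in> J"
  using assms(2) assms(1)[unfolded coord_ideal_iff]
  by (induction A rule: infinite_finite_induct) auto

lemma ideal_add_span:
  assumes "ideal J (coord_ring m r)" "G \<subseteq> J" "x \<in> add_span G"
  shows "x \<in> J"
  using assms(3,2) assms(1)[unfolded coord_ideal_iff]
  by (induction rule: add_span.induct) auto

lemma ideal_pow_0: "ideal_pow m r J 0 = cring_carrier m r"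
  by (simp add: ideal_pow_def nat_pow_def ideals_set_def)

lemma ideal_pow_Suc: "ideal_pow m r J (Suc n) = ideal_prod (coord_ring m r) (ideal_pow m r J n) J"
  by (simp add: ideal_pow_def nat_pow_def ideals_set_def)

lemma ideal_pow_ideal:
  assumes "ideal J (coord_ring m r)"
  shows "ideal (ideal_pow m r J n) (coord_ring m r)"
proof (induction n)
  case 0
  then show ?case
    by (auto simp: ideal_pow_0 coord_ideal_iff carrier_iff[of 0] intro: carrier_add carrier_mult)
next
  case (Suc n)
  then show ?case
    unfolding ideal_pow_Suc
    by (intro ring.ideal_prod_is_ideal cring.axioms(1) coord_ring_cring assms)
qed

lemma ideal_pow_SucI: "x \<in> ideal_pow m r J n \<Longrightarrow> y \<in> J \<Longrightarrow> x * y \<in> ideal_pow m r J (Suc n)"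
  using ideal_prod.prod[of x "ideal_pow m r J n" y J "coord_ring m r"] by (simp add: ideal_pow_Suc)

section \<open>Powers of the irrelevant ideal\<close>

lemma monom_split_var:
  assumes "lookup t v > 0"
  obtains t' :: monom where "t = single v 1 + t'"
proof
  show "t = single v 1 + (t - single v 1)"
    using assms by (intro poly_mapping_eqI) (auto simp: lookup_add lookup_minus lookup_single when_def)
qed

text \<open>
  One variable at a time is moved from the cofactor \<open>w\<close> to the part \<open>u\<close> of prescribed degree.
\<close>
lemma monom_split_degree:
  assumes "keys t \<subseteq> mvars m r" "\<And>i. i \<in> {1..m} \<Longrightarrow> c i \<le> mdeg r t i"
  obtains u w where "t = u + w" "u \<in> monoms m r c" "keys w \<subseteq> mvars m r"
proof -
  have "\<exists>u w. t = u + w \<and> u \<in> monoms m r c \<and> keys w \<subseteq> mvars m r"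
    using assms(2)
  proof (induction "\<Sum>i=1..m. c i" arbitrary: c)
    case 0
    then have "(0::monom) \<in> monoms m r c" by (auto simp: monoms_def)
    then show ?case using assms(1) by (intro exI[of _ 0] exI[of _ t]) auto
  next
    case (Suc n)
    then obtain i where i: "i \<in> {1..m}" "c i > 0"
      by (metis bot_nat_0.not_eq_extremum nat.distinct(1) sum.neutral)
    define e where "e = c(i := c i - 1)"
    have "(\<Sum>k=1..m. c k) = Suc (\<Sum>k=1..m. e k)"
    proof -
      have "(\<Sum>k=1..m. c k) = c i + (\<Sum>k\<in>{1..m} - {i}. c k)"
        using i by (intro sum.remove) auto
      moreover have "(\<Sum>k=1..m. e k) = e i + (\<Sum>k\<in>{1..m} - {i}. e k)"
        using i by (intro sum.remove) auto
      moreover have "(\<Sum>k\<in>{1..m} - {i}. e k) = (\<Sum>k\<in>{1..m} - {i}. c k)"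
        by (intro sum.cong) (auto simp: e_def)
      ultimately show ?thesis using i by (simp add: e_def)
    qed
    then have "n = (\<Sum>k=1..m. e k)" using Suc(2) by simp
    moreover have "e k \<le> mdeg r t k" if "k \<in> {1..m}" for k
      using Suc(3)[OF that] i by (auto simp: e_def)
    ultimately obtain u w where uw: "t = u + w" "u \<in> monoms m r e" "keys w \<subseteq> mvars m r"
      using Suc(1) by blast
    have "mdeg r u i + mdeg r w i \<ge> c i" using Suc(3)[of i] i uw(1) by (simp add: mdeg_add)
    moreover have "mdeg r u i = c i - 1" using uw i by (auto simp: monoms_def e_def)
    ultimately have "mdeg r w i > 0" using i by simp
    then obtain j where j: "j \<le> r i" "lookup w (i, j) > 0"
      unfolding mdeg_def by (metis atLeastAtMost_iff gr0I less_irrefl sum.neutral)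
    then obtain w' where w': "w = single (i, j) 1 + w'" using monom_split_var by blast
    have "keys w' \<subseteq> keys w"
      unfolding w' by (auto simp: in_keys_iff lookup_add)
    moreover have "u + single (i, j) 1 \<in> monoms m r (\<lambda>k. e k + (if k = i then 1 else 0))"
      using monoms_add[OF uw(2) monoms_var[of "(i, j)"]] j i by (auto simp: mvars_def)
    moreover have "monoms m r (\<lambda>k. e k + (if k = i then 1 else 0)) = monoms m r c"
      using i by (intro monoms_cong) (auto simp: e_def)
    ultimately show ?case
      using uw w' by (intro exI[of _ "u + single (i, j) 1"] exI[of _ w']) (auto simp: add_ac)
  qed
  then show ?thesis using that by blast
qed

lemma irrelevant_ideal_ideal: "ideal (irrelevant_ideal m r) (coord_ring m r)"
  unfolding coord_ideal_iff
proof (intro conjI ballI)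
  show "irrelevant_ideal m r \<subseteq> cring_carrier m r" "0 \<in> irrelevant_ideal m r"
    by (auto simp: irrelevant_ideal_def carrier_iff[of 0])
next
  fix p q :: "'a mpoly" assume "p \<in> irrelevant_ideal m r" "q \<in> irrelevant_ideal m r"
  then show "p + q \<in> irrelevant_ideal m r"
    using keys_add[of p q] unfolding irrelevant_ideal_def by (auto intro: carrier_add)
next
  fix p q :: "'a mpoly" assume pq: "p \<in> cring_carrier m r" "q \<in> irrelevant_ideal m r"
  have "mdeg r t i > 0" if "t \<in> keys (p * q)" "i \<in> {1..m}" for t i
  proof -
    from that(1) keys_mult[of p q] obtain u v where "t = u + v" "v \<in> keys q" by blast
    with pq that(2) show ?thesis by (auto simp: irrelevant_ideal_def mdeg_add)
  qed
  with pq show "p * q \<in> irrelevant_ideal m r" by (auto simp: irrelevant_ideal_def intro: carrier_mult)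
qed

text \<open>
  Together with the next lemma this sandwiches the powers of the irrelevant ideal between
  conditions on the degrees of monomials, which makes the saturation accessible degree by degree.
\<close>
lemma irrelevant_pow_mdeg:
  assumes "p \<in> ideal_pow m r (irrelevant_ideal m r) k" "t \<in> keys p" "i \<in> {1..m}"
  shows "k \<le> mdeg r t i"
  using assms(1,2)
proof (induction k arbitrary: p t)
  case (Suc k)
  from Suc(2) show ?case
    unfolding ideal_pow_Suc using Suc(3)
  proof (induction p arbitrary: t rule: ideal_prod.induct)
    case (prod x y)
    then obtain u v where uv: "t = u + v" "u \<in> keys x" "v \<in> keys y" using keys_mult[of x y] by force
    have "mdeg r v i > 0" using prod uv(3) assms(3) by (auto simp: irrelevant_ideal_def)
    then show ?case using Suc.IH[OF prod(1) uv(2)] by (simp add: uv(1) mdeg_add)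
  next
    case (sum x y)
    then show ?case using keys_add[of x y] by auto
  qed
qed simp

text \<open>
  A monomial of degree \<open>(k, \<dots>, k)\<close> is a product of \<open>k\<close> monomials of degree \<open>(1, \<dots>, 1)\<close>.
\<close>
lemma graded_subset_irrelevant_pow:
  assumes "p \<in> graded_comp m r (\<lambda>_. k)"
  shows "p \<in> ideal_pow m r (irrelevant_ideal m r) k"
proof -
  have mon: "single t a \<in> ideal_pow m r (irrelevant_ideal m r) k" if "t \<in> monoms m r (\<lambda>_. k)"
    for t and a :: 'a
    using that
  proof (induction k arbitrary: t a)
    case 0
    then show ?case by (auto simp: ideal_pow_0 carrier_iff monoms_def)
  next
    case (Suc k)
    then have "keys t \<subseteq> mvars m r" "\<And>i. i \<in> {1..m} \<Longrightarrow> k \<le> mdeg r t i" by (auto simp: monoms_def)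
    then obtain u w where uw: "t = u + w" "u \<in> monoms m r (\<lambda>_. k)" "keys w \<subseteq> mvars m r"
      using monom_split_degree[of t m r "\<lambda>_. k"] by metis
    then have "single w a \<in> irrelevant_ideal m r"
      using Suc(2) by (fastforce simp: irrelevant_ideal_def carrier_iff monoms_def mdeg_add)
    then have "single u 1 * single w a \<in> ideal_pow m r (irrelevant_ideal m r) (Suc k)"
      using Suc(1)[OF uw(2), of 1] by (rule ideal_pow_SucI[rotated])
    then show ?case by (simp add: uw mult_single)
  qed
  have J: "ideal (ideal_pow m r (irrelevant_ideal m r) k) (coord_ring m r :: 'a mpoly ring)"
    by (intro ideal_pow_ideal irrelevant_ideal_ideal)
  from assms have "keys p \<subseteq> monoms m r (\<lambda>_. k)" by (simp add: graded_comp_iff)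
  then show ?thesis
    by (induction p rule: mpoly_induct_keys) (use J mon in \<open>auto simp: coord_ideal_iff\<close>)
qed

section \<open>Powers of the base ideal\<close>

abbreviation target_forms :: "nat \<Rightarrow> nat \<Rightarrow> 'a::field mpoly set" where
  "target_forms \<delta> n \<equiv> graded_comp 1 (\<lambda>_. \<delta>) (\<lambda>_. n)"

abbreviation pullback :: "(nat \<Rightarrow> 'a::field mpoly) \<Rightarrow> 'a mpoly \<Rightarrow> 'a mpoly" where
  "pullback f \<equiv> mp_subst (to_proj f)"

text \<open>
  The additive span of this set is the product \<open>X \<cdot> A\<^sub>n\<close> with the space \<open>A\<^sub>n\<close> of pulled back forms of
  degree \<open>n\<close>. For \<open>X\<close> the whole ring it is the \<open>n\<close>-th power of the base ideal; for \<open>X\<close> a graded piece it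
  is a degree part of an \<open>A\<close>-module of finite type.
\<close>
definition form_products :: "(nat \<Rightarrow> 'a::field mpoly) \<Rightarrow> nat \<Rightarrow> 'a mpoly set \<Rightarrow> nat \<Rightarrow> 'a mpoly set" where
  "form_products f \<delta> X n = {p * pullback f \<alpha> | p \<alpha>. p \<in> X \<and> \<alpha> \<in> target_forms \<delta> n}"

lemma to_proj_apply [simp]: "to_proj f (i, j) = f j"
  by (simp add: to_proj_def)

lemma pullback_graded:
  assumes "\<forall>j\<in>{0..\<delta>}. f j \<in> graded_comp m r d" "\<alpha> \<in> target_forms \<delta> n"
  shows "pullback f \<alpha> \<in> graded_comp m r (\<lambda>i. n * d i)"
  using mp_subst_graded[of 1 "\<lambda>_. \<delta>" "to_proj f" m r "\<lambda>_. d", OF _ assms(2)] assms(1)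
  by (simp add: to_proj_def)

lemma target_forms_mult:
  "\<alpha> \<in> target_forms \<delta> n \<Longrightarrow> \<beta> \<in> target_forms \<delta> k \<Longrightarrow> \<alpha> * \<beta> \<in> target_forms \<delta> (n + k)"
  by (rule graded_comp_mult)

lemma target_forms_power: "\<alpha> \<in> target_forms \<delta> n \<Longrightarrow> \<alpha> ^ k \<in> target_forms \<delta> (k * n)"
  by (rule graded_comp_power)

lemma target_forms_var: "j \<le> \<delta> \<Longrightarrow> mp_var (1, j) \<in> target_forms \<delta> 1"
  using graded_comp_var[of "(1, j)" 1 "\<lambda>_. \<delta>"]
  by (subst graded_comp_cong[of 1 _ "\<lambda>k. if k = fst (1, j) then 1 else 0"]) (auto simp: mvars_def)

lemma form_products_ideal:
  fixes f :: "nat \<Rightarrow> 'a::field mpoly"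
  assumes f: "\<forall>j\<in>{0..\<delta>}. f j \<in> graded_comp m r d"
  shows "ideal (add_span (form_products f \<delta> (cring_carrier m r) n)) (coord_ring m r)"
  unfolding coord_ideal_iff
proof (intro conjI ballI subsetI)
  fix x assume "x \<in> add_span (form_products f \<delta> (cring_carrier m r) n)"
  then show "x \<in> cring_carrier m r"
    by (induction rule: add_span.induct)
       (auto simp: form_products_def carrier_iff[of 0]
             intro!: carrier_add carrier_mult graded_comp_carrier[OF pullback_graded[OF f]])
next
  fix p x :: "'a mpoly"
  assume p: "p \<in> cring_carrier m r" and x: "x \<in> add_span (form_products f \<delta> (cring_carrier m r) n)"
  show "p * x \<in> add_span (form_products f \<delta> (cring_carrier m r) n)"
  proof (rule add_span_image[OF x, of "\<lambda>x. p * x"])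
    fix g assume "g \<in> form_products f \<delta> (cring_carrier m r) n"
    then obtain q \<alpha> where g: "g = q * pullback f \<alpha>" "q \<in> cring_carrier m r" "\<alpha> \<in> target_forms \<delta> n"
      by (auto simp: form_products_def)
    have "p * g = (p * q) * pullback f \<alpha>" by (simp add: g mult.assoc)
    then show "p * g \<in> add_span (form_products f \<delta> (cring_carrier m r) n)"
      unfolding form_products_def using g(3) carrier_mult[OF p g(2)] by (intro add_span_base) blast
  qed (auto simp: distrib_left)
qed (auto intro: add_span_add add_span.zero)

text \<open>
  The base ideal is generated by the pullbacks of the coordinates, so its \<open>n\<close>-th power is generated by
  the pullbacks of the monomials of degree \<open>n\<close>.
\<close>
lemma ideal_pow_eq_form_products:
  fixes f :: "nat \<Rightarrow> 'a::field mpoly"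
  assumes f: "\<forall>j\<in>{0..\<delta>}. f j \<in> graded_comp m r d"
    and I: "I = Idl\<^bsub>coord_ring m r\<^esub> (f ` {0..\<delta>})"
  shows "ideal_pow m r I n = add_span (form_products f \<delta> (cring_carrier m r) n)"
proof -
  interpret cring "coord_ring m r :: 'a mpoly ring" by (rule coord_ring_cring)
  have fc: "f ` {0..\<delta>} \<subseteq> cring_carrier m r" using f by (auto intro: graded_comp_carrier)
  have II: "ideal I (coord_ring m r)" unfolding I by (rule genideal_ideal[OF fc])
  have IJ: "I \<subseteq> add_span (form_products f \<delta> (cring_carrier m r) 1)"
    unfolding I
  proof (rule genideal_minimal[OF form_products_ideal[OF f]], rule subsetI)
    fix x assume "x \<in> f ` {0..\<delta>}"
    then obtain j where "j \<le> \<delta>" "x = 1 * pullback f (mp_var (1, j))" by (auto simp: to_proj_def)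
    moreover have "1 \<in> cring_carrier m r" by (rule graded_comp_carrier[OF graded_comp_1])
    ultimately show "x \<in> add_span (form_products f \<delta> (cring_carrier m r) 1)"
      unfolding form_products_def using target_forms_var by (intro add_span_base) blast
  qed
  have fI: "f j \<in> I" if "j \<le> \<delta>" for j
    unfolding I using genideal_self[OF fc] that by auto
  have mon: "mon_subst (to_proj f) t \<in> ideal_pow m r I n" if "t \<in> monoms 1 (\<lambda>_. \<delta>) (\<lambda>_. n)" for t
    using that
  proof (induction n arbitrary: t)
    case 0
    then have "\<forall>j\<in>{0..\<delta>}. lookup t (1, j) = 0" "keys t \<subseteq> mvars 1 (\<lambda>_. \<delta>)"
      by (auto simp: monoms_def mdeg_def)
    then have "v \<notin> keys t" for v by (cases v) (auto simp: mvars_def in_keys_iff)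
    then have "keys t = {}" by blast
    then have "t = 0" by simp
    then show ?case by (auto simp: ideal_pow_0 intro: graded_comp_carrier[OF graded_comp_1])
  next
    case (Suc n)
    have "mdeg (\<lambda>_. \<delta>) t 1 > 0" using Suc(2) by (auto simp: monoms_def)
    then obtain j where j: "j \<le> \<delta>" "lookup t (1, j) > 0"
      unfolding mdeg_def by (metis atLeastAtMost_iff gr0I less_irrefl sum.neutral)
    then obtain w where w: "t = single (1, j) 1 + w" using monom_split_var by blast
    have "keys w \<subseteq> keys t" unfolding w by (auto simp: in_keys_iff lookup_add)
    then have "w \<in> monoms 1 (\<lambda>_. \<delta>) (\<lambda>_. n)"
      using Suc(2) j by (auto simp: monoms_def w mdeg_add mdeg_single_var)
    from ideal_pow_SucI[OF Suc(1)[OF this] fI[OF j(1)]]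
    show ?case by (simp add: w mon_subst_add to_proj_def mult.commute)
  qed
  note Jn = ideal_pow_ideal[OF II, of n, unfolded coord_ideal_iff]
  have sup: "add_span (form_products f \<delta> (cring_carrier m r) n) \<subseteq> ideal_pow m r I n"
  proof (rule subsetI, rule ideal_add_span[OF ideal_pow_ideal[OF II]])
    show "form_products f \<delta> (cring_carrier m r) n \<subseteq> ideal_pow m r I n"
    proof
      fix x assume "x \<in> form_products f \<delta> (cring_carrier m r) n"
      then obtain p \<alpha> where x: "x = p * pullback f \<alpha>" "p \<in> cring_carrier m r" "\<alpha> \<in> target_forms \<delta> n"
        by (auto simp: form_products_def)
      have "keys \<alpha> \<subseteq> monoms 1 (\<lambda>_. \<delta>) (\<lambda>_. n)" using x by (simp add: graded_comp_iff)
      then have "pullback f \<alpha> \<in> ideal_pow m r I n"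
      proof (induction \<alpha> rule: mpoly_induct_keys)
        case (single t a)
        have "mp_const a \<in> cring_carrier m r" by (rule graded_comp_carrier[OF graded_comp_const])
        then show ?case using Jn mon[OF single] by auto
      qed (use Jn in \<open>auto simp: mp_subst_add\<close>)
      then show "x \<in> ideal_pow m r I n" using x Jn by auto
    qed
  qed
  have "ideal_pow m r I n \<subseteq> add_span (form_products f \<delta> (cring_carrier m r) n)"
  proof (induction n)
    case 0
    show ?case
    proof
      fix x assume "x \<in> ideal_pow m r I 0"
      then have "x = x * pullback f 1 \<and> x \<in> cring_carrier m r \<and> 1 \<in> target_forms \<delta> 0"
        by (auto simp: ideal_pow_0 graded_comp_1)
      then show "x \<in> add_span (form_products f \<delta> (cring_carrier m r) 0)"
        unfolding form_products_def by (intro add_span_base) blast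
    qed
  next
    case (Suc n)
    show ?case
    proof
      fix x assume "x \<in> ideal_pow m r I (Suc n)"
      then show "x \<in> add_span (form_products f \<delta> (cring_carrier m r) (Suc n))"
        unfolding ideal_pow_Suc
      proof (induction x rule: ideal_prod.induct)
        case (prod x y)
        have "x * y \<in> add_span (form_products f \<delta> (cring_carrier m r) (Suc n))"
        proof (rule add_span_mult)
          show "x \<in> add_span (form_products f \<delta> (cring_carrier m r) n)" using Suc prod by blast
          show "y \<in> add_span (form_products f \<delta> (cring_carrier m r) 1)" using IJ prod by blast
          fix g h assume "g \<in> form_products f \<delta> (cring_carrier m r) n" "h \<in> form_products f \<delta> (cring_carrier m r) 1"
          then obtain p \<alpha> q \<beta> where *: "g = p * pullback f \<alpha>" "p \<in> cring_carrier m r" "\<alpha> \<in> target_forms \<delta> n"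
            "h = q * pullback f \<beta>" "q \<in> cring_carrier m r" "\<beta> \<in> target_forms \<delta> 1"
            by (auto simp: form_products_def)
          have "g * h = (p * q) * pullback f (\<alpha> * \<beta>)" by (simp add: * mp_subst_mult mult_ac)
          moreover have "p * q \<in> cring_carrier m r" using * by (intro carrier_mult)
          moreover have "\<alpha> * \<beta> \<in> target_forms \<delta> (Suc n)" using target_forms_mult[OF *(3,6)] by simp
          ultimately show "g * h \<in> add_span (form_products f \<delta> (cring_carrier m r) (Suc n))"
            unfolding form_products_def by (intro add_span_base) blast
        qed
        then show ?case by simp
      qed (auto intro: add_span_add)
    qed
  qed
  with sup show ?thesis by blast
qed

text \<open>
  Taking the homogeneous component of each summand replaces the coefficient \<open>p\<close> in \<open>p \<cdot> \<phi> \<alpha>\<close> by its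
  component of degree \<open>c\<close>.
\<close>
lemma form_products_homogeneous:
  assumes f: "\<forall>j\<in>{0..\<delta>}. f j \<in> graded_comp m r d"
    and x: "x \<in> add_span (form_products f \<delta> (cring_carrier m r) n)"
    and xd: "x \<in> graded_comp m r (\<lambda>i. c i + n * d i)"
  shows "x \<in> add_span (form_products f \<delta> (graded_comp m r c) n)"
proof -
  have "hcomp m r (\<lambda>i. c i + n * d i) x \<in> add_span (form_products f \<delta> (graded_comp m r c) n)"
  proof (rule add_span_image[OF x hcomp_0 hcomp_add])
    fix g assume "g \<in> form_products f \<delta> (cring_carrier m r) n"
    then obtain q \<alpha> where g: "g = q * pullback f \<alpha>" "q \<in> cring_carrier m r" "\<alpha> \<in> target_forms \<delta> n"
      by (auto simp: form_products_def)
    then show "hcomp m r (\<lambda>i. c i + n * d i) g \<in> add_span (form_products f \<delta> (graded_comp m r c) n)"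
      using hcomp_graded[OF g(2)]
      by (intro add_span_base) (auto simp: form_products_def hcomp_mult_graded[OF pullback_graded[OF f g(3)]])
  qed
  then show ?thesis using hcomp_id[OF xd] by simp
qed

section \<open>Images of points and dominance\<close>

lemma target_decomp:
  assumes "p \<in> cring_carrier 1 (\<lambda>_. \<delta>)"
  obtains M where "p = (\<Sum>n\<le>M. hcomp 1 (\<lambda>_. \<delta>) (\<lambda>_. n) p)" "\<And>n. n > M \<Longrightarrow> hcomp 1 (\<lambda>_. \<delta>) (\<lambda>_. n) p = 0"
proof -
  define M where "M = Max ((\<lambda>t. mdeg (\<lambda>_. \<delta>) t 1) ` insert 0 (keys p))"
  have M: "mdeg (\<lambda>_. \<delta>) t 1 \<le> M" if "t \<in> keys p" for t
    unfolding M_def using that by (intro Max_ge) auto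
  have hc: "lookup (hcomp 1 (\<lambda>_. \<delta>) (\<lambda>_. n) p) t = (if n = mdeg (\<lambda>_. \<delta>) t 1 then lookup p t else 0)" for n t
    by (auto simp: lookup_hcomp)
  show ?thesis
  proof
    show "p = (\<Sum>n\<le>M. hcomp 1 (\<lambda>_. \<delta>) (\<lambda>_. n) p)"
      using M by (intro poly_mapping_eqI) (auto simp: lookup_sum hc in_keys_iff simp del: One_nat_def)
    show "hcomp 1 (\<lambda>_. \<delta>) (\<lambda>_. n) p = 0" if "n > M" for n
      using M that by (intro poly_mapping_eqI) (fastforce simp: hc in_keys_iff simp del: One_nat_def)
  qed
qed

lemma target_comp_mult:
  fixes p q :: "'a::field mpoly"
  assumes p: "p \<in> cring_carrier 1 (\<lambda>_. \<delta>)" and q: "q \<in> cring_carrier 1 (\<lambda>_. \<delta>)"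
  shows "hcomp 1 (\<lambda>_. \<delta>) (\<lambda>_. n) (p * q)
    = (\<Sum>k\<le>n. hcomp 1 (\<lambda>_. \<delta>) (\<lambda>_. k) p * hcomp 1 (\<lambda>_. \<delta>) (\<lambda>_. n - k) q)"
proof -
  let ?h = "\<lambda>n. hcomp 1 (\<lambda>_. \<delta>) (\<lambda>_. n) :: 'a mpoly \<Rightarrow> 'a mpoly"
  obtain M where M: "p = (\<Sum>k\<le>M. ?h k p)" "\<And>k. k > M \<Longrightarrow> ?h k p = 0"
    using target_decomp[OF p] by blast
  have "?h n (p * q) = ?h n ((\<Sum>k\<le>M. ?h k p) * q)" using M(1) by simp
  also have "\<dots> = (\<Sum>k\<le>M. ?h n (q * ?h k p))"
    by (simp only: mult.commute[of _ q] sum_distrib_left hcomp_sum)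
  also have "\<dots> = (\<Sum>k\<le>M. if k \<le> n then ?h k p * ?h (n - k) q else 0)"
  proof (intro sum.cong refl)
    fix k
    have kp: "?h k p \<in> target_forms \<delta> k" by (rule hcomp_graded[OF p])
    show "?h n (q * ?h k p) = (if k \<le> n then ?h k p * ?h (n - k) q else 0)"
    proof (cases "k \<le> n")
      case True
      then show ?thesis using hcomp_mult_graded[OF kp, of "\<lambda>_. n - k" q] by (simp add: mult.commute)
    next
      case False
      have "lookup (?h n (q * ?h k p)) t = 0" for t
      proof (rule ccontr)
        assume "lookup (?h n (q * ?h k p)) t \<noteq> 0"
        then have "mdeg (\<lambda>_. \<delta>) t 1 = n" "t \<in> keys (q * ?h k p)"
          by (auto simp: lookup_hcomp in_keys_iff split: if_splits)
        then obtain u w where "t = u + w" "w \<in> keys (?h k p)" using keys_mult by blast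
        with kp have "mdeg (\<lambda>_. \<delta>) t 1 \<ge> k" by (auto simp: graded_comp_iff monoms_def mdeg_add)
        with \<open>mdeg (\<lambda>_. \<delta>) t 1 = n\<close> False show False by simp
      qed
      with False show ?thesis by (auto intro: poly_mapping_eqI)
    qed
  qed
  also have "\<dots> = (\<Sum>k\<le>max M n. if k \<le> n then ?h k p * ?h (n - k) q else 0)"
    using M(2) by (intro sum.mono_neutral_left) auto
  also have "\<dots> = (\<Sum>k\<le>n. ?h k p * ?h (n - k) q)"
    by (intro sum.mono_neutral_cong_right) auto
  finally show ?thesis .
qed

lemma primeideal_iff:
  "primeideal P (coord_ring m r) \<longleftrightarrow> ideal P (coord_ring m r) \<and> 1 \<notin> P \<and>
     (\<forall>a\<in>cring_carrier m r. \<forall>b\<in>cring_carrier m r. a * b \<in> P \<longrightarrow> a \<in> P \<or> b \<in> P)" (is "_ \<longleftrightarrow> ?rhs")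
proof
  assume P: "primeideal P (coord_ring m r)"
  interpret primeideal P "coord_ring m r" by fact
  have "1 \<notin> P" using one_imp_carrier I_notcarr by auto
  then show ?rhs using is_ideal I_prime by auto
next
  assume P: ?rhs
  have "cring_carrier m r \<noteq> P" using P graded_comp_carrier[OF graded_comp_1] by blast
  with P show "primeideal P (coord_ring m r)"
    by (intro primeidealI coord_ring_cring) auto
qed

text \<open>
  The generic point.
\<close>
lemma zero_in_multiproj:
  assumes "m \<ge> 1"
  shows "{0 :: 'a::field mpoly} \<in> multiproj m r"
proof -
  interpret cring "coord_ring m r :: 'a mpoly ring" by (rule coord_ring_cring)
  have "primeideal {0 :: 'a mpoly} (coord_ring m r)"
    by (auto simp: primeideal_iff coord_ideal_iff carrier_iff[of 0])
  moreover have "{0} = Idl\<^bsub>coord_ring m r\<^esub> {p \<in> {0 :: 'a mpoly}. multihomogeneous m r p}"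
  proof -
    have "multihomogeneous m r (0 :: 'a mpoly)" by (auto simp: multihomogeneous_def)
    then have "{p \<in> {0 :: 'a mpoly}. multihomogeneous m r p} = {0}" by auto
    then show ?thesis using genideal_zero by simp
  qed
  moreover have "\<not> irrelevant_ideal m r \<subseteq> {0 :: 'a mpoly}"
  proof -
    have "(\<Prod>i=1..m. mp_var (i, 0)) \<in> (irrelevant_ideal m r :: 'a mpoly set)"
      using zeroth_coordinates_product[of m r, where ?'a = 'a]
      by (auto simp: irrelevant_ideal_def graded_comp_def)
    moreover have "(\<Prod>i=1..m. mp_var (i, 0)) \<noteq> (0 :: 'a mpoly)" by simp
    ultimately show ?thesis by blast
  qed
  ultimately show ?thesis unfolding multiproj_def by blast
qed

text \<open>
  The closed sets that test dominance consist of points, so the image of a point has to be recognised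
  as a point. The ideal in question consists of the polynomials all of whose components are pulled
  back into \<open>P\<close>. Primality has to be proved with components: the preimage of \<open>P\<close> under the
  inhomogeneous pullback need not be a homogeneous ideal if \<open>d = 0\<close>.
\<close>
lemma map_point_in_multiproj:
  fixes f :: "nat \<Rightarrow> 'a::field mpoly"
  assumes f: "\<forall>j\<in>{0..\<delta>}. f j \<in> graded_comp m r d"
    and P: "P \<in> map_domain m r 1 (\<lambda>_. \<delta>) (to_proj f)"
  shows "map_point 1 (\<lambda>_. \<delta>) (to_proj f) P \<in> multiproj 1 (\<lambda>_. \<delta>)"
proof -
  let ?s = "\<lambda>_::nat. \<delta>" and ?S = "cring_carrier 1 (\<lambda>_. \<delta>) :: 'a mpoly set"
  let ?h = "\<lambda>n. hcomp 1 (\<lambda>_. \<delta>) (\<lambda>_. n) :: 'a mpoly \<Rightarrow> 'a mpoly"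
  interpret S: cring "coord_ring 1 ?s :: 'a mpoly ring" by (rule coord_ring_cring)
  have prime: "primeideal P (coord_ring m r)" using P by (simp add: map_domain_def multiproj_def)
  then have ideal: "ideal P (coord_ring m r)" and P1: "1 \<notin> P"
    and P_prime: "\<And>a b. a \<in> cring_carrier m r \<Longrightarrow> b \<in> cring_carrier m r \<Longrightarrow> a * b \<in> P \<Longrightarrow> a \<in> P \<or> b \<in> P"
    by (auto simp: primeideal_iff)
  note PI = ideal[unfolded coord_ideal_iff]
  have pull: "pullback f \<alpha> \<in> cring_carrier m r" if "\<alpha> \<in> target_forms \<delta> n" for \<alpha> n
    using pullback_graded[OF f that] by (rule graded_comp_carrier)
  have hS: "?h n a \<in> target_forms \<delta> n" if "a \<in> ?S" for a n using that by (rule hcomp_graded)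
  define H where "H = {h. multihomogeneous 1 ?s h \<and> pullback f h \<in> P}"
  define Q where "Q = {h \<in> ?S. \<forall>n. pullback f (?h n h) \<in> P}"
  have mh: "multihomogeneous 1 ?s h \<longleftrightarrow> (\<exists>n. h \<in> target_forms \<delta> n)" for h :: "'a mpoly"
  proof -
    have "graded_comp 1 ?s c = (target_forms \<delta> (c 1) :: 'a mpoly set)" for c
      by (rule graded_comp_cong) simp
    then show ?thesis unfolding multihomogeneous_def by blast
  qed
  have HQ: "H \<subseteq> Q"
  proof
    fix h assume "h \<in> H"
    then obtain k where k: "h \<in> target_forms \<delta> k" "pullback f h \<in> P" unfolding H_def mh by blast
    have "pullback f (?h n h) \<in> P" for n
    proof (cases "n = k")
      case True
      then show ?thesis using k by (simp add: hcomp_id)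
    next
      case False
      have "?h n h = 0" using False by (intro hcomp_other[OF k(1), of 1]) auto
      then show ?thesis using PI by simp
    qed
    with k(1) show "h \<in> Q" by (auto simp: Q_def dest: graded_comp_carrier)
  qed
  have mult_in: "pullback f (\<Sum>k\<le>n. ?h k a * ?h (n - k) b) \<in> P"
    if "a \<in> ?S" "b \<in> ?S" "\<And>k. k \<le> n \<Longrightarrow> pullback f (?h k a) \<in> P \<or> pullback f (?h (n - k) b) \<in> P" for a b n
    unfolding mp_subst_sum mp_subst_mult
  proof (rule ideal_sum[OF ideal])
    fix k assume "k \<in> {..n}"
    with that(3)[of k] pull[OF hS[OF that(1)]] pull[OF hS[OF that(2)]] PI
    show "pullback f (?h k a) * pullback f (?h (n - k) b) \<in> P"
      by (metis atMost_iff mult.commute)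
  qed
  have QI: "ideal Q (coord_ring 1 ?s)"
    unfolding coord_ideal_iff
  proof (intro conjI ballI)
    show "Q \<subseteq> ?S" "0 \<in> Q" using PI by (auto simp: Q_def carrier_iff[of 0])
  next
    fix a b assume "a \<in> Q" "b \<in> Q"
    then show "a + b \<in> Q" using PI by (auto simp: Q_def hcomp_add mp_subst_add intro: carrier_add)
  next
    fix a b assume "a \<in> ?S" "b \<in> Q"
    then show "a * b \<in> Q"
      using mult_in[of a b] by (auto simp: Q_def target_comp_mult simp del: One_nat_def intro: carrier_mult)
  qed
  have "Q \<subseteq> Idl\<^bsub>coord_ring 1 ?s\<^esub> H"
  proof
    fix h assume h: "h \<in> Q"
    then have hc: "h \<in> ?S" by (simp add: Q_def)
    have HS: "H \<subseteq> ?S" using HQ by (auto simp: Q_def)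
    obtain M where M: "h = (\<Sum>n\<le>M. ?h n h)" using target_decomp[OF hc] by blast
    have "?h n h \<in> H" for n using h hS[OF hc] unfolding Q_def H_def mh by blast
    then have "?h n h \<in> Idl\<^bsub>coord_ring 1 ?s\<^esub> H" for n using S.genideal_self[OF HS] by blast
    then have "(\<Sum>n\<le>M. ?h n h) \<in> Idl\<^bsub>coord_ring 1 ?s\<^esub> H"
      by (intro ideal_sum[OF S.genideal_ideal[OF HS]])
    with M show "h \<in> Idl\<^bsub>coord_ring 1 ?s\<^esub> H" by simp
  qed
  with S.genideal_minimal[OF QI HQ] have Q: "Idl\<^bsub>coord_ring 1 ?s\<^esub> H = Q" by blast
  have Qprime: "primeideal Q (coord_ring 1 ?s)"
    unfolding primeideal_iff
  proof (intro conjI ballI impI QI)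
    show "1 \<notin> Q"
      using P1 hcomp_id[OF graded_comp_1[of 1 ?s, where ?'a = 'a]]
      by (auto simp: Q_def intro!: exI[of _ 0])
  next
    fix a b assume a: "a \<in> ?S" and b: "b \<in> ?S" and ab: "a * b \<in> Q"
    show "a \<in> Q \<or> b \<in> Q"
    proof (rule ccontr)
      assume "\<not> (a \<in> Q \<or> b \<in> Q)"
      with a b have ex: "\<exists>i. pullback f (?h i a) \<notin> P" "\<exists>j. pullback f (?h j b) \<notin> P" by (auto simp: Q_def)
      \<comment> \<open>In degree \<open>i + j\<close> the product of the lowest components outside \<open>P\<close> is the only summand
         that could fail to lie in \<open>P\<close>.\<close>
      define i where "i = (LEAST i. pullback f (?h i a) \<notin> P)"
      define j where "j = (LEAST j. pullback f (?h j b) \<notin> P)"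
      have i: "pullback f (?h i a) \<notin> P" "\<And>k. k < i \<Longrightarrow> pullback f (?h k a) \<in> P"
        unfolding i_def using LeastI_ex[OF ex(1)] not_less_Least by blast+
      have j: "pullback f (?h j b) \<notin> P" "\<And>k. k < j \<Longrightarrow> pullback f (?h k b) \<in> P"
        unfolding j_def using LeastI_ex[OF ex(2)] not_less_Least by blast+
      have all: "pullback f (?h (i + j) (a * b)) \<in> P" using ab by (simp add: Q_def)
      have split: "?h (i + j) (a * b) = ?h i a * ?h j b + (\<Sum>k\<in>{..i + j} - {i}. ?h k a * ?h (i + j - k) b)"
        unfolding target_comp_mult[OF a b] by (subst sum.remove[of _ i]) auto
      have rest: "pullback f (\<Sum>k\<in>{..i + j} - {i}. ?h k a * ?h (i + j - k) b) \<in> P"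
        unfolding mp_subst_sum mp_subst_mult
      proof (rule ideal_sum[OF ideal])
        fix k assume "k \<in> {..i + j} - {i}"
        then have "k < i \<or> i + j - k < j" by auto
        then have "pullback f (?h k a) \<in> P \<or> pullback f (?h (i + j - k) b) \<in> P" using i(2) j(2) by blast
        with pull[OF hS[OF a]] pull[OF hS[OF b]] PI
        show "pullback f (?h k a) * pullback f (?h (i + j - k) b) \<in> P" by (metis mult.commute)
      qed
      have "pullback f (?h i a) * pullback f (?h j b)
          = pullback f (?h (i + j) (a * b)) + - pullback f (\<Sum>k\<in>{..i + j} - {i}. ?h k a * ?h (i + j - k) b)"
        unfolding split by (simp add: mp_subst_add mp_subst_mult)
      moreover have "pullback f (?h (i + j) (a * b))
          + - pullback f (\<Sum>k\<in>{..i + j} - {i}. ?h k a * ?h (i + j - k) b) \<in> P"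
        using all ideal_uminus[OF ideal rest] PI by blast
      ultimately have "pullback f (?h i a) * pullback f (?h j b) \<in> P" by (simp only:)
      with P_prime[OF pull[OF hS[OF a]] pull[OF hS[OF b]]] i(1) j(1) show False by blast
    qed
  qed
  have "Q = Idl\<^bsub>coord_ring 1 ?s\<^esub> {p \<in> Q. multihomogeneous 1 ?s p}"
  proof
    show "Idl\<^bsub>coord_ring 1 ?s\<^esub> {p \<in> Q. multihomogeneous 1 ?s p} \<subseteq> Q"
      by (rule S.genideal_minimal[OF QI]) auto
    have "H \<subseteq> {p \<in> Q. multihomogeneous 1 ?s p}" using HQ by (auto simp: H_def)
    then have "H \<subseteq> Idl\<^bsub>coord_ring 1 ?s\<^esub> {p \<in> Q. multihomogeneous 1 ?s p}"
      using S.genideal_self[of "{p \<in> Q. multihomogeneous 1 ?s p}"] by (auto simp: Q_def)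
    moreover have "ideal (Idl\<^bsub>coord_ring 1 ?s\<^esub> {p \<in> Q. multihomogeneous 1 ?s p}) (coord_ring 1 ?s)"
      by (rule S.genideal_ideal) (auto simp: Q_def)
    ultimately show "Q \<subseteq> Idl\<^bsub>coord_ring 1 ?s\<^esub> {p \<in> Q. multihomogeneous 1 ?s p}"
      using S.genideal_minimal Q by blast
  qed
  moreover have "\<not> irrelevant_ideal 1 ?s \<subseteq> Q"
  proof -
    obtain j where j: "j \<le> \<delta>" "f j \<notin> P" using P by (auto simp: map_domain_def)
    have y: "(mp_var (1, j) :: 'a mpoly) \<in> target_forms \<delta> 1" by (rule target_forms_var[OF j(1)])
    then have "(mp_var (1, j) :: 'a mpoly) \<in> irrelevant_ideal 1 ?s"
      by (auto simp: irrelevant_ideal_def graded_comp_def)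
    moreover have "mp_var (1, j) \<notin> Q"
      using hcomp_id[OF y] j(2) unfolding Q_def by (auto intro!: exI[of _ 1])
    ultimately show ?thesis by blast
  qed
  moreover have "map_point 1 ?s (to_proj f) P = Q" unfolding map_point_def H_def[symmetric] by (rule Q)
  ultimately show ?thesis using Qprime unfolding multiproj_def by auto
qed

text \<open>
  If \<open>\<alpha>\<close> is pulled back to zero, the hypersurface of \<open>\<alpha>\<close> contains the images of all points in the
  domain; by dominance it contains the generic point as well.
\<close>
lemma dominant_imp_graded_injective:
  fixes f :: "nat \<Rightarrow> 'a::field mpoly"
  assumes f: "\<forall>j\<in>{0..\<delta>}. f j \<in> graded_comp m r d"
    and dom: "dominant m r 1 (\<lambda>_. \<delta>) (to_proj f)"
    and \<alpha>: "\<alpha> \<in> target_forms \<delta> n" "pullback f \<alpha> = 0"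
  shows "\<alpha> = 0"
proof -
  let ?s = "\<lambda>_::nat. \<delta>"
  interpret S: cring "coord_ring 1 ?s :: 'a mpoly ring" by (rule coord_ring_cring)
  define Z where "Z = {P \<in> multiproj 1 ?s. {\<alpha>} \<subseteq> P}"
  have hom: "multihomogeneous 1 ?s \<alpha>" using \<alpha>(1) by (auto simp: multihomogeneous_def)
  have "zariski_closed 1 ?s Z"
    unfolding zariski_closed_def Z_def using hom by (intro exI[of _ "{\<alpha>}"]) simp
  moreover have "map_point 1 ?s (to_proj f) ` map_domain m r 1 ?s (to_proj f) \<subseteq> Z"
  proof (rule image_subsetI)
    fix P assume P: "P \<in> map_domain m r 1 ?s (to_proj f)"
    have "ideal P (coord_ring m r)" using P by (simp add: map_domain_def multiproj_def primeideal_iff)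
    then have "0 \<in> P" by (simp add: coord_ideal_iff)
    let ?H = "{h. multihomogeneous 1 ?s h \<and> pullback f h \<in> P}"
    have "?H \<subseteq> carrier (coord_ring 1 ?s)" by (auto simp: multihomogeneous_def dest: graded_comp_carrier)
    moreover have "\<alpha> \<in> ?H" using hom \<alpha>(2) \<open>0 \<in> P\<close> by simp
    ultimately have "\<alpha> \<in> map_point 1 ?s (to_proj f) P"
      unfolding map_point_def using S.genideal_self by blast
    then show "map_point 1 ?s (to_proj f) P \<in> Z"
      using map_point_in_multiproj[OF f P] by (simp add: Z_def)
  qed
  ultimately have "Z = multiproj 1 ?s" using dom unfolding dominant_def by blast
  then have "{0} \<in> Z" using zero_in_multiproj[of 1 ?s, where ?'a = 'a] by simp
  then show ?thesis by (simp add: Z_def)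
qed

section \<open>Leading monomials and division\<close>

text \<open>
  The order is the lexicographic one on exponent functions. Its compatibility with addition
  makes leading monomials multiplicative; the finiteness of the set of monomials of a given degree makes
  division terminate.
\<close>
definition lead :: "'a::zero mpoly \<Rightarrow> monom" where
  "lead p = Max (keys p)"

lemma lead_in_keys: "p \<noteq> 0 \<Longrightarrow> lead p \<in> keys p"
  unfolding lead_def by (intro Max_in) auto

lemma lead_ge: "t \<in> keys p \<Longrightarrow> t \<le> lead p"
  unfolding lead_def by (intro Max_ge) auto

lemma lead_eqI: "t \<in> keys p \<Longrightarrow> (\<And>u. u \<in> keys p \<Longrightarrow> u \<le> t) \<Longrightarrow> lead p = t"
  unfolding lead_def by (intro Max_eqI) auto

text \<open>
  All terms of the product other than the product of the leading terms have strictly smaller monomials.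
\<close>
lemma lookup_lead_mult:
  fixes p q :: "'a::field mpoly"
  assumes "p \<noteq> 0" "q \<noteq> 0"
  shows "lookup (p * q) (lead p + lead q) = lookup p (lead p) * lookup q (lead q)"
proof -
  define p' q' where "p' = p - single (lead p) (lookup p (lead p))" and "q' = q - single (lead q) (lookup q (lead q))"
  have rest: "u < lead x" if "u \<in> keys (x - single (lead x) (lookup x (lead x)))" for u and x :: "'a mpoly"
  proof -
    from that have "u \<noteq> lead x" "u \<in> keys x"
      by (auto simp: in_keys_iff lookup_minus lookup_single when_def split: if_splits)
    then show ?thesis using lead_ge by force
  qed
  have "lead p + lead q \<notin> keys (single (lead p) (lookup p (lead p)) * q')"
  proof
    assume "lead p + lead q \<in> keys (single (lead p) (lookup p (lead p)) * q')"
    with keys_mult obtain v where "v \<in> keys q'" "lead p + lead q = lead p + v"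
      by (force split: if_splits)
    then show False using rest unfolding q'_def by fastforce
  qed
  moreover have "lead p + lead q \<notin> keys (p' * q)"
  proof
    assume "lead p + lead q \<in> keys (p' * q)"
    with keys_mult obtain u v where uv: "u \<in> keys p'" "v \<in> keys q" "lead p + lead q = u + v" by force
    then have "u < lead p" "v \<le> lead q" using rest lead_ge unfolding p'_def by auto
    then have "u + v < lead p + lead q" by (rule add_less_le_mono)
    with uv show False by simp
  qed
  moreover have "p * q = single (lead p + lead q) (lookup p (lead p) * lookup q (lead q)) +
      (single (lead p) (lookup p (lead p)) * q' + p' * q)"
    unfolding p'_def q'_def by (simp add: algebra_simps mult_single)
  ultimately show ?thesis by (simp add: lookup_add in_keys_iff)
qed

lemma lead_mult:
  fixes p q :: "'a::field mpoly"
  assumes "p \<noteq> 0" "q \<noteq> 0"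
  shows "lead (p * q) = lead p + lead q"
proof (rule lead_eqI)
  show "lead p + lead q \<in> keys (p * q)"
    using lead_in_keys assms by (auto simp: in_keys_iff lookup_lead_mult)
  fix u assume "u \<in> keys (p * q)"
  then obtain a b where "u = a + b" "a \<in> keys p" "b \<in> keys q" using keys_mult[of p q] by blast
  then show "u \<le> lead p + lead q" using lead_ge by (auto intro: add_mono)
qed

lemma lookup_lead_power:
  fixes p :: "'a::field mpoly"
  shows "p \<noteq> 0 \<Longrightarrow> lookup (lead (p ^ n)) v = n * lookup (lead p) v"
proof (induction n)
  case 0
  have "lead (1 :: 'a mpoly) = 0" by (rule lead_eqI) auto
  then show ?case by simp
next
  case (Suc n)
  then have "p ^ n \<noteq> 0" by simp
  with Suc show ?case by (simp add: lead_mult lookup_add)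
qed

text \<open>
  A form of the statement that a polynomial ring is completely integrally closed. The divisibilities
  hold for \<open>a\<close> if and only if they hold for \<open>a + x b\<close>, by the binomial theorem. So it suffices that the
  leading monomial of \<open>b\<close> divides that of \<open>a\<close>, because then the leading term of \<open>a\<close> can be cancelled
  and the procedure repeated. Let \<open>k\<close>, \<open>l\<close> and \<open>u\<close> be the exponents of a variable in the
  leading monomials of \<open>a\<close>, \<open>b\<close> and \<open>\<epsilon>\<close>. Comparing leading monomials in \<open>\<epsilon> a\<^sup>s = b\<^sup>s q\<close> gives
  \<open>s l \<le> u + s k\<close> for all \<open>s\<close>, which forces \<open>l \<le> k\<close>.
\<close>
lemma almost_integral_quotient:
  fixes a b \<epsilon> :: "'a::field mpoly"
  assumes b: "b \<in> graded_comp m r e" "b \<noteq> 0" and \<epsilon>: "\<epsilon> \<noteq> 0"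
    and a: "a \<in> graded_comp m r (\<lambda>i. e i + n i)" "\<And>s. b ^ s dvd \<epsilon> * a ^ s"
  shows "\<exists>\<kappa>\<in>graded_comp m r n. a = \<kappa> * b"
  using a
proof (induction "card {t \<in> monoms m r (\<lambda>i. e i + n i). \<exists>u\<in>keys a. t \<le> u}" arbitrary: a rule: less_induct)
  case less
  show ?case
  proof (cases "a = 0")
    case True
    then show ?thesis by (intro bexI[of _ 0]) auto
  next
    case False
    have le: "lookup (lead b) v \<le> lookup (lead a) v" for v
    proof -
      \<comment> \<open>With \<open>s\<close> larger than the exponent in \<open>\<epsilon>\<close>, an excess of the exponent in \<open>b\<close>
         cannot be made up for by \<open>\<epsilon>\<close>.\<close>
      define s where "s = Suc (lookup (lead \<epsilon>) v)"
      obtain q where q: "\<epsilon> * a ^ s = b ^ s * q" using less(3)[of s] by (auto elim: dvdE)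
      with False \<epsilon> have "q \<noteq> 0" by (metis mult_eq_0_iff power_not_zero)
      then have "lead \<epsilon> + lead (a ^ s) = lead (b ^ s) + lead q"
        using q False \<epsilon> b(2) by (metis lead_mult power_not_zero)
      then have "lookup (lead \<epsilon>) v + s * lookup (lead a) v = s * lookup (lead b) v + lookup (lead q) v"
        using False b(2) by (metis lookup_add lookup_lead_power)
      then have "s * lookup (lead b) v < s * (lookup (lead a) v + 1)" by (simp add: s_def)
      then show ?thesis by (metis Suc_eq_plus1 less_Suc_eq_le mult_less_cancel1)
    qed
    \<comment> \<open>One step of polynomial division: cancel the leading term of \<open>a\<close>.\<close>
    define \<gamma> where "\<gamma> = lead a - lead b"
    have lead_a: "lead a = lead b + \<gamma>"
      using le unfolding \<gamma>_def by (intro poly_mapping_eqI) (simp add: lookup_add lookup_minus)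
    have la: "lead a \<in> monoms m r (\<lambda>i. e i + n i)" and lb: "lead b \<in> monoms m r e"
      using lead_in_keys[OF False] lead_in_keys[OF b(2)] less(2) b(1) by (auto simp: graded_comp_iff)
    have "keys \<gamma> \<subseteq> keys (lead a)" unfolding lead_a by (auto simp: in_keys_iff lookup_add)
    with la lb have \<gamma>: "\<gamma> \<in> monoms m r n" by (auto simp: monoms_def lead_a mdeg_add)
    define x where "x = single \<gamma> (lookup a (lead a) / lookup b (lead b))"
    define a' where "a' = a - x * b"
    have x: "x \<in> graded_comp m r n" unfolding x_def by (rule graded_comp_single[OF \<gamma>])
    have xb: "x * b \<in> graded_comp m r (\<lambda>i. e i + n i)"
      using graded_comp_mult[OF x b(1)] by (simp add: add.commute)
    have a': "a' \<in> graded_comp m r (\<lambda>i. e i + n i)"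
      unfolding a'_def by (rule graded_comp_diff[OF less(2) xb])
    have x0: "x \<noteq> 0" and lead_x: "lead x = \<gamma>" "lookup x \<gamma> = lookup a (lead a) / lookup b (lead b)"
    proof -
      have "lookup a (lead a) / lookup b (lead b) \<noteq> 0"
        using lead_in_keys[OF False] lead_in_keys[OF b(2)] by (simp add: in_keys_iff)
      then show "lead x = \<gamma>" "lookup x \<gamma> = lookup a (lead a) / lookup b (lead b)"
        unfolding x_def by (auto intro!: lead_eqI)
      then show "x \<noteq> 0" using \<open>lookup a (lead a) / lookup b (lead b) \<noteq> 0\<close> by auto
    qed
    have lead_xb: "lead (x * b) = lead a"
      using lead_mult[OF x0 b(2)] by (simp add: lead_x lead_a add.commute)
    have "lookup (x * b) (lead a) = lookup a (lead a)"
      using lookup_lead_mult[OF x0 b(2)] lead_in_keys[OF b(2)]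
      by (simp add: lead_x lead_a add.commute in_keys_iff)
    then have "lead a \<notin> keys a'" by (simp add: in_keys_iff a'_def lookup_minus)
    moreover have "u \<le> lead a" if "u \<in> keys a'" for u
    proof -
      have "u \<in> keys a \<or> u \<in> keys (x * b)" using that by (auto simp: a'_def in_keys_iff lookup_minus)
      then show ?thesis using lead_ge lead_xb by metis
    qed
    ultimately have smaller: "u < lead a" if "u \<in> keys a'" for u using that by (metis order_less_le)
    have "{t \<in> monoms m r (\<lambda>i. e i + n i). \<exists>u\<in>keys a'. t \<le> u}
        \<subset> {t \<in> monoms m r (\<lambda>i. e i + n i). \<exists>u\<in>keys a. t \<le> u}"
    proof
      show "{t \<in> monoms m r (\<lambda>i. e i + n i). \<exists>u\<in>keys a'. t \<le> u}
        \<subseteq> {t \<in> monoms m r (\<lambda>i. e i + n i). \<exists>u\<in>keys a. t \<le> u}"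
        using smaller lead_in_keys[OF False] by (auto intro!: bexI[of _ "lead a"] dest!: smaller)
      have "lead a \<in> {t \<in> monoms m r (\<lambda>i. e i + n i). \<exists>u\<in>keys a. t \<le> u}"
        using la lead_in_keys[OF False] by auto
      moreover have "lead a \<notin> {t \<in> monoms m r (\<lambda>i. e i + n i). \<exists>u\<in>keys a'. t \<le> u}"
        using smaller by force
      ultimately show "{t \<in> monoms m r (\<lambda>i. e i + n i). \<exists>u\<in>keys a'. t \<le> u}
        \<noteq> {t \<in> monoms m r (\<lambda>i. e i + n i). \<exists>u\<in>keys a. t \<le> u}" by blast
    qed
    then have "card {t \<in> monoms m r (\<lambda>i. e i + n i). \<exists>u\<in>keys a'. t \<le> u}
        < card {t \<in> monoms m r (\<lambda>i. e i + n i). \<exists>u\<in>keys a. t \<le> u}"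
      by (intro psubset_card_mono) auto
    moreover have "b ^ s dvd \<epsilon> * a' ^ s" for s
    proof -
      have "a' ^ s = (\<Sum>k\<le>s. of_nat (s choose k) * a ^ k * (- x * b) ^ (s - k))"
        unfolding a'_def using binomial_ring[of a "- x * b" s] by simp
      then have "\<epsilon> * a' ^ s = (\<Sum>k\<le>s. \<epsilon> * (of_nat (s choose k) * a ^ k * (- x * b) ^ (s - k)))"
        by (simp add: sum_distrib_left)
      moreover have "b ^ s dvd \<epsilon> * (of_nat (s choose k) * a ^ k * (- x * b) ^ (s - k))" if "k \<le> s" for k
      proof -
        have "b ^ k * b ^ (s - k) dvd (\<epsilon> * a ^ k) * (- x * b) ^ (s - k)"
          using less(3)[of k] by (intro mult_dvd_mono) (auto simp: dvd_power_same)
        then have "b ^ s dvd (\<epsilon> * a ^ k) * (- x * b) ^ (s - k)"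
          using that by (simp add: power_add[symmetric])
        then have "b ^ s dvd of_nat (s choose k) * ((\<epsilon> * a ^ k) * (- x * b) ^ (s - k))" by (rule dvd_mult)
        then show ?thesis by (simp add: mult_ac)
      qed
      ultimately show ?thesis by (auto intro: dvd_sum)
    qed
    ultimately obtain \<kappa> where \<kappa>: "\<kappa> \<in> graded_comp m r n" "a' = \<kappa> * b"
      using less(1)[OF _ a'] by blast
    then have "a = (\<kappa> + x) * b" by (simp add: a'_def algebra_simps)
    then show ?thesis using graded_comp_add[OF \<kappa>(1) x] by blast
  qed
qed

section \<open>Proportional coordinates\<close>

lemma mp_var_power: "mp_var v ^ n = (single (single v n) 1 :: 'a::comm_semiring_1 mpoly)"
  by (induction n) (auto simp: mp_var_def mult_single single_add[symmetric])

lemma mon_subst_mp_var: "mon_subst mp_var t = (single t 1 :: 'a::comm_semiring_1 mpoly)"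
proof -
  have "(\<Prod>v\<in>A. single (h v) 1) = (single (\<Sum>v\<in>A. h v) 1 :: 'a mpoly)" for A and h :: "nat \<times> nat \<Rightarrow> monom"
    by (induction A rule: infinite_finite_induct) (auto simp: mult_single)
  then have "mon_subst mp_var t = (single (\<Sum>v\<in>keys t. single v (lookup t v)) 1 :: 'a mpoly)"
    by (simp add: mon_subst_def mp_var_power)
  then show ?thesis using poly_mapping_eq_sum_single[of "keys t" t] by simp
qed

text \<open>
  A polynomial identity version of \<open>p(G) / p(x) = \<Prod>\<^sub>i (G\<^sub>i\<^sub>,\<^sub>0 / x\<^sub>i\<^sub>,\<^sub>0)\<^bsup>c i\<^esup>\<close>: if \<open>G\<close> represents the
  identity map, then on each factor its coordinates are a common multiple of the variables.
\<close>
lemma proportional_subst: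
  fixes G :: "nat \<times> nat \<Rightarrow> 'a::field mpoly"
  assumes G: "\<And>i j. i \<in> {1..m} \<Longrightarrow> j \<le> r i \<Longrightarrow> G (i, j) * mp_var (i, 0) = G (i, 0) * mp_var (i, j)"
    and p: "p \<in> graded_comp m r c"
  shows "p * (\<Prod>i=1..m. G (i, 0) ^ c i) = mp_subst G p * (\<Prod>i=1..m. mp_var (i, 0) ^ c i)"
proof -
  have mon: "single t 1 * (\<Prod>i=1..m. G (i, 0) ^ c i) = mon_subst G t * (\<Prod>i=1..m. mp_var (i, 0) ^ c i)"
    if t: "t \<in> monoms m r c" for t
  proof -
    have sup: "mon_subst g t = (\<Prod>i=1..m. \<Prod>j=0..r i. g (i, j) ^ lookup t (i, j))"
      for g :: "nat \<times> nat \<Rightarrow> 'a mpoly"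
      using t by (subst mon_subst_superset[of "mvars m r"]) (auto simp: monoms_def prod_mvars)
    have c: "(\<Prod>i=1..m. g (i, 0) ^ c i) = (\<Prod>i=1..m. \<Prod>j=0..r i. g (i, 0) ^ lookup t (i, j))"
      for g :: "nat \<times> nat \<Rightarrow> 'a mpoly"
      using t by (intro prod.cong) (auto simp: monoms_def mdeg_def power_sum[symmetric])
    have "mon_subst mp_var t * (\<Prod>i=1..m. G (i, 0) ^ c i)
        = (\<Prod>i=1..m. \<Prod>j=0..r i. (mp_var (i, j) * G (i, 0)) ^ lookup t (i, j))"
      unfolding sup c by (simp add: prod.distrib power_mult_distrib)
    also have "\<dots> = (\<Prod>i=1..m. \<Prod>j=0..r i. (G (i, j) * mp_var (i, 0)) ^ lookup t (i, j))"
      using G by (intro prod.cong refl) (simp add: mult.commute)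
    also have "\<dots> = mon_subst G t * (\<Prod>i=1..m. mp_var (i, 0) ^ c i)"
      unfolding sup c by (simp add: prod.distrib power_mult_distrib)
    finally show ?thesis by (simp add: mon_subst_mp_var)
  qed
  have "keys p \<subseteq> monoms m r c" using p by (simp add: graded_comp_iff)
  then show ?thesis
  proof (induction p rule: mpoly_induct_keys)
    case (single t a)
    have "single t a * (\<Prod>i=1..m. G (i, 0) ^ c i) = mp_const a * (single t 1 * (\<Prod>i=1..m. G (i, 0) ^ c i))"
      by (simp add: mult.assoc[symmetric])
    then show ?case by (simp only: mon[OF single] mp_subst_single mult.assoc)
  qed (auto simp: mp_subst_add distrib_right)
qed

text \<open>
  The ratio \<open>p / q\<close> of two forms of equal degree is a rational function, hence unchanged by a
  representative \<open>G\<close> of the identity map.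
\<close>
lemma proportional_subst_swap:
  fixes G :: "nat \<times> nat \<Rightarrow> 'a::field mpoly"
  assumes G: "\<And>i j. i \<in> {1..m} \<Longrightarrow> j \<le> r i \<Longrightarrow> G (i, j) * mp_var (i, 0) = G (i, 0) * mp_var (i, j)"
    and G0: "\<And>i. i \<in> {1..m} \<Longrightarrow> G (i, 0) \<noteq> 0"
    and p: "p \<in> graded_comp m r c" and q: "q \<in> graded_comp m r c"
  shows "p * mp_subst G q = mp_subst G p * q"
proof -
  let ?W = "\<Prod>i=1..m. G (i, 0) ^ c i" and ?X = "\<Prod>i=1..m. mp_var (i, 0) ^ c i :: 'a mpoly"
  have "?W \<noteq> 0" using G0 by simp
  have "(p * mp_subst G q) * ?W = (p * ?W) * mp_subst G q" by (simp add: mult_ac)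
  also have "\<dots> = mp_subst G p * (mp_subst G q * ?X)"
    by (simp only: proportional_subst[where G = G, OF G p] mult_ac)
  also have "\<dots> = (mp_subst G p * q) * ?W"
    by (simp only: proportional_subst[where G = G, OF G q, symmetric] mult_ac)
  finally show ?thesis using \<open>?W \<noteq> 0\<close> mult_right_cancel by blast
qed

lemma proportional_subst_nonzero:
  fixes G :: "nat \<times> nat \<Rightarrow> 'a::field mpoly"
  assumes G: "\<And>i j. i \<in> {1..m} \<Longrightarrow> j \<le> r i \<Longrightarrow> G (i, j) * mp_var (i, 0) = G (i, 0) * mp_var (i, j)"
    and G0: "\<And>i. i \<in> {1..m} \<Longrightarrow> G (i, 0) \<noteq> 0"
    and p: "p \<in> graded_comp m r c" "p \<noteq> 0"
  shows "mp_subst G p \<noteq> 0"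
proof
  assume "mp_subst G p = 0"
  then have "p * (\<Prod>i=1..m. G (i, 0) ^ c i) = 0"
    using proportional_subst[where G = G, OF G p(1)] by simp
  with p(2) G0 show False by simp
qed

section \<open>Sections of the saturation as multipliers\<close>

text \<open>
  A power of the irrelevant ideal that carries \<open>h\<close> into \<open>I\<^sup>n\<close> contains the graded piece of degree
  \<open>(k, \<dots>, k)\<close>; comparing degrees leaves coefficients from the same piece.
\<close>
lemma saturation_multiplier:
  fixes f :: "nat \<Rightarrow> 'a::field mpoly"
  assumes f: "\<forall>j\<in>{0..\<delta>}. f j \<in> graded_comp m r d"
    and I: "I = Idl\<^bsub>coord_ring m r\<^esub> (f ` {0..\<delta>})"
    and h: "h \<in> graded_comp m r (\<lambda>i. n * d i)" "h \<in> saturation m r (ideal_pow m r I n)"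
  obtains k where "\<And>p. p \<in> graded_comp m r (\<lambda>_. k) \<Longrightarrow>
    h * p \<in> add_span (form_products f \<delta> (graded_comp m r (\<lambda>_. k)) n)"
proof -
  from h(2) obtain k where k: "\<forall>q\<in>ideal_pow m r (irrelevant_ideal m r) k. q * h \<in> ideal_pow m r I n"
    by (auto simp: saturation_def)
  show ?thesis
  proof (rule that[of k])
    fix p :: "'a mpoly" assume p: "p \<in> graded_comp m r (\<lambda>_. k)"
    then have "p * h \<in> ideal_pow m r I n" using k graded_subset_irrelevant_pow by blast
    then show "h * p \<in> add_span (form_products f \<delta> (graded_comp m r (\<lambda>_. k)) n)"
      using graded_comp_mult[OF p h(1)]
      by (intro form_products_homogeneous[OF f])
         (simp_all add: ideal_pow_eq_form_products[OF f I] mult.commute)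
  qed
qed

text \<open>
  A power of the irrelevant ideal with exponent \<open>k \<ge> c i\<close> for all \<open>i\<close> is contained in the ideal generated
  by the monomials of degree \<open>c\<close>.
\<close>
lemma multiplier_in_saturation:
  fixes f :: "nat \<Rightarrow> 'a::field mpoly"
  assumes f: "\<forall>j\<in>{0..\<delta>}. f j \<in> graded_comp m r d"
    and I: "I = Idl\<^bsub>coord_ring m r\<^esub> (f ` {0..\<delta>})"
    and h: "h \<in> cring_carrier m r"
    and mult: "\<And>p. p \<in> graded_comp m r c \<Longrightarrow> h * p \<in> add_span (form_products f \<delta> (graded_comp m r c) n)"
  shows "h \<in> saturation m r (ideal_pow m r I n)"
proof -
  define k where "k = (\<Sum>i=1..m. c i)"
  have ck: "c i \<le> k" if "i \<in> {1..m}" for i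
    unfolding k_def using that by (intro member_le_sum) auto
  note P = ideal_pow_eq_form_products[OF f I, of n]
  note J = form_products_ideal[OF f, of n, unfolded coord_ideal_iff]
  have mon: "single t a * h \<in> ideal_pow m r I n"
    if t: "keys t \<subseteq> mvars m r" "\<And>i. i \<in> {1..m} \<Longrightarrow> k \<le> mdeg r t i" for t a
  proof -
    have "c i \<le> mdeg r t i" if "i \<in> {1..m}" for i using ck[OF that] t(2)[OF that] by simp
    with t(1) obtain u w where uw: "t = u + w" "u \<in> monoms m r c" "keys w \<subseteq> mvars m r"
      by (rule monom_split_degree) blast
    have "h * single u 1 \<in> add_span (form_products f \<delta> (graded_comp m r c) n)"
      by (rule mult[OF graded_comp_single[OF uw(2)]])
    moreover have "form_products f \<delta> (graded_comp m r c) n \<subseteq> form_products f \<delta> (cring_carrier m r) n"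
      by (auto simp: form_products_def dest: graded_comp_carrier)
    ultimately have "h * single u 1 \<in> ideal_pow m r I n" unfolding P by (rule add_span_mono)
    moreover have "single w a \<in> cring_carrier m r" using uw(3) by (auto simp: carrier_iff)
    ultimately have "single w a * (h * single u 1) \<in> ideal_pow m r I n" unfolding P using J by blast
    moreover have "single w a * (h * single u 1) = (single u 1 * single w a) * h" by (simp only: mult_ac)
    ultimately show ?thesis by (simp add: uw(1) mult_single)
  qed
  have "q * h \<in> ideal_pow m r I n" if q: "q \<in> ideal_pow m r (irrelevant_ideal m r) k" for q
  proof -
    have "q \<in> cring_carrier m r"
      using q ideal_pow_ideal[OF irrelevant_ideal_ideal, of m r k] unfolding coord_ideal_iff by blast
    then have "keys q \<subseteq> {t. keys t \<subseteq> mvars m r \<and> (\<forall>i\<in>{1..m}. k \<le> mdeg r t i)}"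
      using irrelevant_pow_mdeg[OF q] by (auto simp: carrier_iff)
    then show ?thesis
      by (induction q rule: mpoly_induct_keys) (use J mon in \<open>auto simp: P distrib_right\<close>)
  qed
  with h show ?thesis by (auto simp: saturation_def)
qed

lemma form_products_mult:
  fixes f :: "nat \<Rightarrow> 'a::field mpoly"
  assumes x: "x \<in> add_span (form_products f \<delta> X n)" and \<eta>: "\<eta> \<in> target_forms \<delta> k"
  shows "x * pullback f \<eta> \<in> add_span (form_products f \<delta> X (n + k))"
proof (rule add_span_image[OF x, of "\<lambda>x. x * pullback f \<eta>"])
  fix z assume "z \<in> form_products f \<delta> X n"
  then obtain q \<theta> where z: "z = q * pullback f \<theta>" "q \<in> X" "\<theta> \<in> target_forms \<delta> n"
    by (auto simp: form_products_def)
  have "z * pullback f \<eta> = q * pullback f (\<theta> * \<eta>)" by (simp add: z mp_subst_mult mult.assoc)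
  then show "z * pullback f \<eta> \<in> add_span (form_products f \<delta> X (n + k))"
    unfolding form_products_def using z(2) target_forms_mult[OF z(3) \<eta>]
    by (intro add_span_base) blast
qed (auto simp: distrib_right)

text \<open>
  The graded piece of degree zero consists of constants, which pullback absorbs.
\<close>
lemma form_products_constants:
  fixes f :: "nat \<Rightarrow> 'a::field mpoly"
  assumes x: "x \<in> add_span (form_products f \<delta> (graded_comp m r (\<lambda>_. 0)) n)"
  obtains \<alpha> where "\<alpha> \<in> target_forms \<delta> n" "x = pullback f \<alpha>"
proof -
  have "\<exists>\<alpha>\<in>target_forms \<delta> n. x = pullback f \<alpha>"
    using x
  proof (induction rule: add_span.induct)
    case zero
    then show ?case by (intro bexI[of _ 0]) auto
  next
    case (step g x)
    then obtain p \<beta> \<alpha> where *: "g = p * pullback f \<beta>" "p \<in> graded_comp m r (\<lambda>_. 0)"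
      "\<beta> \<in> target_forms \<delta> n" "\<alpha> \<in> target_forms \<delta> n" "x = pullback f \<alpha>"
      by (auto simp: form_products_def)
    have "t = 0" if t: "t \<in> keys p" for t
    proof -
      from t *(2) have "\<forall>i\<in>{1..m}. \<forall>j\<in>{0..r i}. lookup t (i, j) = 0" "keys t \<subseteq> mvars m r"
        by (auto simp: graded_comp_iff monoms_def mdeg_def)
      then have "v \<notin> keys t" for v by (cases v) (auto simp: mvars_def in_keys_iff)
      then have "keys t = {}" by blast
      then show ?thesis by simp
    qed
    then have "keys p \<subseteq> {0}" by blast
    from poly_mapping_eq_sum_single[OF _ this] have "p = mp_const (lookup p 0)" by (simp add: mp_const_def)
    then obtain a where p: "p = mp_const a" by blast
    have "g + x = pullback f (mp_const a * \<beta> + \<alpha>)"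
      by (simp add: * p mp_subst_add mp_subst_mult)
    moreover have "mp_const a * \<beta> + \<alpha> \<in> target_forms \<delta> n"
      using * by (intro graded_comp_add graded_comp_const_mult)
    ultimately show ?case by blast
  qed
  then show ?thesis using that by blast
qed

lemma ideal_comp_pow_eq_pullbacks:
  fixes f :: "nat \<Rightarrow> 'a::field mpoly"
  assumes f: "\<forall>j\<in>{0..\<delta>}. f j \<in> graded_comp m r d"
    and I: "I = Idl\<^bsub>coord_ring m r\<^esub> (f ` {0..\<delta>})"
  shows "ideal_comp m r (ideal_pow m r I n) (\<lambda>i. n * d i) = pullback f ` target_forms \<delta> n"
proof (intro equalityI subsetI)
  fix x assume "x \<in> ideal_comp m r (ideal_pow m r I n) (\<lambda>i. n * d i)"
  then have "x \<in> add_span (form_products f \<delta> (graded_comp m r (\<lambda>_. 0)) n)"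
    by (intro form_products_homogeneous[OF f]) (auto simp: ideal_comp_def ideal_pow_eq_form_products[OF f I])
  then show "x \<in> pullback f ` target_forms \<delta> n"
    by (rule form_products_constants) blast
next
  fix x assume "x \<in> pullback f ` target_forms \<delta> n"
  then obtain \<alpha> where \<alpha>: "\<alpha> \<in> target_forms \<delta> n" "x = 1 * pullback f \<alpha>" by auto
  then have "x \<in> form_products f \<delta> (cring_carrier m r) n"
    unfolding form_products_def using graded_comp_carrier[OF graded_comp_1] by blast
  then show "x \<in> ideal_comp m r (ideal_pow m r I n) (\<lambda>i. n * d i)"
    unfolding ideal_comp_def ideal_pow_eq_form_products[OF f I]
    using pullback_graded[OF f \<alpha>(1)] \<alpha>(2) by (auto intro: add_span_base)
qed

lemma ideal_comp_subset_saturation: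
  fixes I :: "'a::field mpoly set"
  assumes "ideal I (coord_ring m r)"
  shows "ideal_comp m r (ideal_pow m r I n) c \<subseteq> ideal_comp m r (saturation m r (ideal_pow m r I n)) c"
proof
  note J = ideal_pow_ideal[OF assms, of n, unfolded coord_ideal_iff]
  fix x assume x: "x \<in> ideal_comp m r (ideal_pow m r I n) c"
  then have "\<forall>q\<in>ideal_pow m r (irrelevant_ideal m r) 0. q * x \<in> ideal_pow m r I n"
    using J by (simp add: ideal_comp_def ideal_pow_0)
  moreover have "x \<in> cring_carrier m r" using x J by (auto simp: ideal_comp_def)
  ultimately show "x \<in> ideal_comp m r (saturation m r (ideal_pow m r I n)) c"
    using x unfolding ideal_comp_def saturation_def by blast
qed

section \<open>Birational maps have saturated powers\<close>

text \<open>
  Here \<open>g\<close> represents an inverse and \<open>G\<close> its composite with the given map. Exchanging arguments under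
  \<open>G\<close> writes \<open>h\<close> as a quotient \<open>\<alpha> / \<beta>\<close> of pulled back forms, and shows that \<open>e(G)\<close> multiplies every element
  of \<open>R\<^sub>c A\<close> into \<open>e A\<close>. The elements \<open>h\<^sup>s e\<close> all belong to \<open>R\<^sub>c A\<close>, so \<open>e(G) h\<^sup>s \<in> A\<close> for all \<open>s\<close>. All degrees are
  recorded because pullback is known to be injective on forms only.
\<close>
lemma sections_are_forms:
  fixes f :: "nat \<Rightarrow> 'a::field mpoly" and g :: "nat \<times> nat \<Rightarrow> 'a mpoly" and h e :: "'a mpoly"
  assumes f: "\<forall>j\<in>{0..\<delta>}. f j \<in> graded_comp m r d"
    and f0: "j0 \<le> \<delta>" "f j0 \<noteq> 0"
    and inj: "\<And>n \<alpha>. \<alpha> \<in> target_forms \<delta> n \<Longrightarrow> pullback f \<alpha> = 0 \<Longrightarrow> \<alpha> = 0"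
    and g: "\<And>i j. i \<in> {1..m} \<Longrightarrow> j \<le> r i \<Longrightarrow> g (i, j) \<in> target_forms \<delta> (\<gamma> i)"
    and G: "\<And>i j. i \<in> {1..m} \<Longrightarrow> j \<le> r i \<Longrightarrow>
      pullback f (g (i, j)) * mp_var (i, 0) = pullback f (g (i, 0)) * mp_var (i, j)"
    and G0: "\<And>i. i \<in> {1..m} \<Longrightarrow> pullback f (g (i, 0)) \<noteq> 0"
    and h: "h \<in> graded_comp m r (\<lambda>i. n * d i)"
    and mult: "\<And>p. p \<in> graded_comp m r c \<Longrightarrow> h * p \<in> add_span (form_products f \<delta> (graded_comp m r c) n)"
    and e: "e \<in> graded_comp m r c" "e \<noteq> 0"
  shows "h \<in> pullback f ` target_forms \<delta> n"
proof -
  define \<Gamma> where "\<Gamma> = (\<lambda>c. \<Sum>i=1..m. c i * \<gamma> i)"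
  have gsub: "mp_subst g p \<in> target_forms \<delta> (\<Gamma> c')" if "p \<in> graded_comp m r c'" for p c'
    unfolding \<Gamma>_def using mp_subst_graded[of m r g 1 "\<lambda>_. \<delta>" "\<lambda>i _. \<gamma> i", OF g that] .
  let ?G = "\<lambda>v. pullback f (g v)"
  have comp: "pullback f (mp_subst g p) = mp_subst ?G p" for p by (rule mp_subst_mp_subst)
  have swap: "p * mp_subst ?G q = mp_subst ?G p * q"
    if "p \<in> graded_comp m r c'" "q \<in> graded_comp m r c'" for p q c'
    using proportional_subst_swap[where G = ?G, OF G G0 that] .
  have nz: "mp_subst ?G p \<noteq> 0" if "p \<in> graded_comp m r c'" "p \<noteq> 0" for p c'
    using proportional_subst_nonzero[where G = ?G, OF G G0 that] .

  define nd where "nd = (\<lambda>i. n * d i)"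
  \<comment> \<open>A nonzero pulled back form of the same degree as \<open>h\<close>: then
     \<open>h / F = h(G) / F(G)\<close> with \<open>F(G)\<close> and \<open>h(G)\<close> in \<open>A\<close>, and \<open>F\<close> itself is in \<open>A\<close>.\<close>
  define F where "F = f j0 ^ n"
  have F: "F \<in> graded_comp m r nd" "F \<noteq> 0"
    unfolding F_def nd_def using f f0 by (auto intro!: graded_comp_power)
  define \<beta> where "\<beta> = mp_subst g F"
  define \<alpha> where "\<alpha> = mp_subst g h * mp_var (1, j0) ^ n"
  have \<beta>: "\<beta> \<in> target_forms \<delta> (\<Gamma> nd)" unfolding \<beta>_def by (rule gsub[OF F(1)])
  have \<alpha>: "\<alpha> \<in> target_forms \<delta> (\<Gamma> nd + n)"
    unfolding \<alpha>_def
    using target_forms_mult[OF gsub[OF h] target_forms_power[OF target_forms_var[OF f0(1)], of n]]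
    by (simp add: nd_def)
  have h_frac: "h * pullback f \<beta> = pullback f \<alpha>"
    unfolding \<alpha>_def \<beta>_def
    using swap[OF h F(1)[unfolded nd_def]] by (simp add: comp mp_subst_mult mp_subst_power F_def)
  have \<beta>0: "pullback f \<beta> \<noteq> 0" unfolding \<beta>_def comp by (rule nz[OF F])
  then have "\<beta> \<noteq> 0" by auto

  define \<epsilon> where "\<epsilon> = mp_subst g e"
  have \<epsilon>: "\<epsilon> \<in> target_forms \<delta> (\<Gamma> c)" unfolding \<epsilon>_def by (rule gsub[OF e(1)])
  have "pullback f \<epsilon> \<noteq> 0" unfolding \<epsilon>_def comp by (rule nz[OF e])
  then have "\<epsilon> \<noteq> 0" by auto

  have mult_all: "h * x \<in> add_span (form_products f \<delta> (graded_comp m r c) (n + k))"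
    if x: "x \<in> add_span (form_products f \<delta> (graded_comp m r c) k)" for x k
  proof (rule add_span_image[OF x, of "\<lambda>x. h * x"])
    fix y assume "y \<in> form_products f \<delta> (graded_comp m r c) k"
    then obtain p \<eta> where y: "y = p * pullback f \<eta>" "p \<in> graded_comp m r c" "\<eta> \<in> target_forms \<delta> k"
      by (auto simp: form_products_def)
    have "(h * p) * pullback f \<eta> \<in> add_span (form_products f \<delta> (graded_comp m r c) (n + k))"
      by (rule form_products_mult[OF mult[OF y(2)] y(3)])
    then show "h * y \<in> add_span (form_products f \<delta> (graded_comp m r c) (n + k))"
      by (simp add: y(1) mult.assoc)
  qed (auto simp: distrib_left)
  have powers: "h ^ s * e \<in> add_span (form_products f \<delta> (graded_comp m r c) (s * n))" for s
  proof (induction s)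
    case 0
    have "e * pullback f 1 \<in> form_products f \<delta> (graded_comp m r c) 0"
      unfolding form_products_def using e(1) graded_comp_1 by blast
    then show ?case using add_span_base by fastforce
  next
    case (Suc s)
    from mult_all[OF this] show ?case by (simp add: mult.assoc)
  qed
  \<comment> \<open>The element \<open>e(G)\<close> clears denominators because \<open>e(G) p = e p(G)\<close>.\<close>
  have clear: "\<exists>\<eta>\<in>target_forms \<delta> (\<Gamma> c + k). pullback f \<epsilon> * x = e * pullback f \<eta>"
    if "x \<in> add_span (form_products f \<delta> (graded_comp m r c) k)" for x k
    using that
  proof (induction rule: add_span.induct)
    case zero
    then show ?case by (intro bexI[of _ 0]) auto
  next
    case (step y x)
    then obtain p \<theta> \<eta> where y: "y = p * pullback f \<theta>" "p \<in> graded_comp m r c" "\<theta> \<in> target_forms \<delta> k"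
      and x: "\<eta> \<in> target_forms \<delta> (\<Gamma> c + k)" "pullback f \<epsilon> * x = e * pullback f \<eta>"
      by (auto simp: form_products_def)
    have "pullback f \<epsilon> * y = e * pullback f (mp_subst g p * \<theta>)"
      using swap[OF y(2) e(1)] by (simp add: y(1) \<epsilon>_def comp mp_subst_mult) (simp add: algebra_simps)
    then have "pullback f \<epsilon> * (y + x) = e * pullback f (mp_subst g p * \<theta> + \<eta>)"
      by (simp add: distrib_left x(2) mp_subst_add)
    moreover have "mp_subst g p * \<theta> + \<eta> \<in> target_forms \<delta> (\<Gamma> c + k)"
      by (intro graded_comp_add x(1) target_forms_mult gsub y)
    ultimately show ?case by blast
  qed
  have "\<beta> ^ s dvd \<epsilon> * \<alpha> ^ s" for s
  proof -
    obtain \<eta> where \<eta>: "\<eta> \<in> target_forms \<delta> (\<Gamma> c + s * n)" "pullback f \<epsilon> * (h ^ s * e) = e * pullback f \<eta>"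
      using clear[OF powers] by blast
    then have *: "pullback f \<epsilon> * h ^ s = pullback f \<eta>" using e(2) by (simp add: mult_ac)
    have "pullback f (\<epsilon> * \<alpha> ^ s) = pullback f \<epsilon> * (h * pullback f \<beta>) ^ s"
      by (simp add: mp_subst_mult mp_subst_power h_frac)
    also have "\<dots> = pullback f (\<eta> * \<beta> ^ s)"
      by (simp add: power_mult_distrib mp_subst_mult mp_subst_power *[symmetric])
    finally have "pullback f (\<epsilon> * \<alpha> ^ s - \<eta> * \<beta> ^ s) = 0" by (simp add: mp_subst_diff)
    moreover have "\<epsilon> * \<alpha> ^ s \<in> target_forms \<delta> (\<Gamma> c + s * (\<Gamma> nd + n))"
      by (intro target_forms_mult target_forms_power \<epsilon> \<alpha>)
    moreover have "\<eta> * \<beta> ^ s \<in> target_forms \<delta> (\<Gamma> c + s * (\<Gamma> nd + n))"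
      using target_forms_mult[OF \<eta>(1) target_forms_power[OF \<beta>, of s]] by (simp add: algebra_simps)
    ultimately have "\<epsilon> * \<alpha> ^ s - \<eta> * \<beta> ^ s = 0" using inj graded_comp_diff by blast
    then show ?thesis by (metis dvd_triv_right eq_iff_diff_eq_0)
  qed
  with \<alpha> \<beta> \<open>\<beta> \<noteq> 0\<close> \<open>\<epsilon> \<noteq> 0\<close>
  obtain \<kappa> where \<kappa>: "\<kappa> \<in> target_forms \<delta> n" "\<alpha> = \<kappa> * \<beta>"
    using almost_integral_quotient[of \<beta> 1 "\<lambda>_. \<delta>" "\<lambda>_. \<Gamma> nd" \<epsilon> \<alpha> "\<lambda>_. n"] by blast
  then have "h * pullback f \<beta> = pullback f \<kappa> * pullback f \<beta>" by (simp add: h_frac mp_subst_mult)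
  then have "h = pullback f \<kappa>" using \<beta>0 by simp
  with \<kappa>(1) show ?thesis by blast
qed

text \<open>
  The exponent \<open>k\<close> of the multiplier property fixes the graded piece, and the nonzero element
  required there is a power of the product of the coordinates \<open>x\<^sub>i\<^sub>,\<^sub>0\<close>.
\<close>
lemma birational_imp_saturated:
  fixes f :: "nat \<Rightarrow> 'a::field mpoly"
  assumes f: "\<forall>j\<in>{0..\<delta>}. f j \<in> graded_comp m r d"
    and I: "I = Idl\<^bsub>coord_ring m r\<^esub> (f ` {0..\<delta>})"
    and inj: "\<And>n \<alpha>. \<alpha> \<in> target_forms \<delta> n \<Longrightarrow> pullback f \<alpha> = 0 \<Longrightarrow> \<alpha> = 0"
    and bir: "birational m r 1 (\<lambda>_. \<delta>) (to_proj f)"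
    and h: "h \<in> ideal_comp m r (saturation m r (ideal_pow m r I n)) (\<lambda>i. n * d i)"
  shows "h \<in> ideal_comp m r (ideal_pow m r I n) (\<lambda>i. n * d i)"
proof -
  from bir obtain g where rf: "rational_map m r 1 (\<lambda>_. \<delta>) (to_proj f)"
    and rg: "rational_map 1 (\<lambda>_. \<delta>) m r g"
    and rc: "rational_map m r m r (\<lambda>v. pullback f (g v))"
    and same: "same_rational_map m r (\<lambda>v. pullback f (g v)) mp_var"
    unfolding birational_def by blast
  from rf obtain j0 where j0: "j0 \<le> \<delta>" "f j0 \<noteq> 0" by (auto simp: rational_map_def to_proj_def)
  have "\<exists>k. \<forall>j\<in>{0..r i}. g (i, j) \<in> target_forms \<delta> k" if i: "i \<in> {1..m}" for i
  proof -
    obtain c where c: "\<forall>j\<in>{0..r i}. g (i, j) \<in> graded_comp 1 (\<lambda>_. \<delta>) c"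
      using rg i unfolding rational_map_def by blast
    have "graded_comp 1 (\<lambda>_. \<delta>) c = target_forms \<delta> (c 1)" by (rule graded_comp_cong) simp
    with c show ?thesis by blast
  qed
  then obtain \<gamma> where \<gamma>: "\<And>i. i \<in> {1..m} \<Longrightarrow> \<forall>j\<in>{0..r i}. g (i, j) \<in> target_forms \<delta> (\<gamma> i)"
    by metis
  have G: "pullback f (g (i, j)) * mp_var (i, l) = pullback f (g (i, l)) * mp_var (i, j)"
    if "i \<in> {1..m}" "j \<le> r i" "l \<le> r i" for i j l
    using same that unfolding same_rational_map_def by auto
  have G0: "pullback f (g (i, 0)) \<noteq> 0" if i: "i \<in> {1..m}" for i
  proof
    assume 0: "pullback f (g (i, 0)) = 0"
    obtain j where "j \<le> r i" "pullback f (g (i, j)) \<noteq> 0"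
      using rc i unfolding rational_map_def by (meson atLeastAtMost_iff)
    with G[OF i, of j 0] 0 show False by simp
  qed
  have h': "h \<in> graded_comp m r (\<lambda>i. n * d i)" "h \<in> saturation m r (ideal_pow m r I n)"
    using h by (auto simp: ideal_comp_def)
  then obtain k where k: "\<And>p. p \<in> graded_comp m r (\<lambda>_. k) \<Longrightarrow>
    h * p \<in> add_span (form_products f \<delta> (graded_comp m r (\<lambda>_. k)) n)"
    using saturation_multiplier[OF f I] by blast
  have e: "(\<Prod>i=1..m. mp_var (i, 0)) ^ k \<in> (graded_comp m r (\<lambda>_. k) :: 'a mpoly set)"
    using graded_comp_power[OF zeroth_coordinates_product, where n = k] by simp
  have "h \<in> pullback f ` target_forms \<delta> n"
  proof (rule sections_are_forms[OF f j0 inj, where g = g and \<gamma> = \<gamma>, OF _ _ _ _ _ h'(1) k e])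
    show "(\<Prod>i=1..m. mp_var (i, 0)) ^ k \<noteq> (0 :: 'a mpoly)" by simp
  qed (use \<gamma> G G0 in auto)
  then show ?thesis by (simp add: ideal_comp_pow_eq_pullbacks[OF f I])
qed

section \<open>Counting monomials\<close>

text \<open>
  The exponents of the variables \<open>x\<^sub>i\<^sub>,\<^sub>j\<close> with \<open>j \<ge> 1\<close> are at most \<open>c i\<close> and determine the monomial, because the
  degree gives the exponents of \<open>x\<^sub>i\<^sub>,\<^sub>0\<close>.
\<close>
lemma card_monoms_le: "card (monoms m r c) \<le> (\<Prod>i=1..m. (c i + 1) ^ r i)"
proof -
  let ?V = "SIGMA i:{1..m}. {1..r i}" and ?F = "\<lambda>v::nat \<times> nat. {..c (fst v)}"
  have "inj_on (\<lambda>t. restrict (lookup t) ?V) (monoms m r c)"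
  proof (rule inj_onI)
    fix t u assume t: "t \<in> monoms m r c" and u: "u \<in> monoms m r c"
      and eq: "restrict (lookup t) ?V = restrict (lookup u) ?V"
    have same: "lookup t (i, j) = lookup u (i, j)" if "i \<in> {1..m}" "j \<in> {1..r i}" for i j
      using fun_cong[OF eq, of "(i, j)"] that by auto
    have split: "mdeg r w i = lookup w (i, 0) + (\<Sum>j=1..r i. lookup w (i, j))" for w i
      unfolding mdeg_def by (simp add: sum.atLeast_Suc_atMost)
    have "lookup t (i, 0) = lookup u (i, 0)" if i: "i \<in> {1..m}" for i
    proof -
      have "mdeg r t i = mdeg r u i" using t u i by (simp add: monoms_def)
      moreover have "(\<Sum>j=1..r i. lookup t (i, j)) = (\<Sum>j=1..r i. lookup u (i, j))"
        using same[OF i] by (intro sum.cong) auto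
      ultimately show ?thesis by (simp add: split)
    qed
    with same have inside: "lookup t (i, j) = lookup u (i, j)" if "i \<in> {1..m}" "j \<le> r i" for i j
      using that by (cases "j = 0") auto
    have "lookup t v = lookup u v" for v
    proof (cases "v \<in> mvars m r")
      case True
      then show ?thesis using inside by (auto simp: mvars_def)
    next
      case False
      then have "v \<notin> keys t" "v \<notin> keys u" using t u by (auto simp: monoms_def)
      then show ?thesis by (simp add: in_keys_iff)
    qed
    then show "t = u" by (rule poly_mapping_eqI)
  qed
  moreover have "(\<lambda>t. restrict (lookup t) ?V) ` monoms m r c \<subseteq> PiE ?V ?F"
  proof (clarsimp simp: PiE_iff)
    fix t i j assume t: "t \<in> monoms m r c" and i: "Suc 0 \<le> i" "i \<le> m" "j \<le> r i"
    have "lookup t (i, j) \<le> mdeg r t i" unfolding mdeg_def using i by (intro member_le_sum) auto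
    also have "\<dots> = c i" using t i by (auto simp: monoms_def)
    finally show "lookup t (i, j) \<le> c i" .
  qed
  ultimately have "card (monoms m r c) \<le> card (PiE ?V ?F)"
    by (intro card_inj_on_le[where f = "\<lambda>t. restrict (lookup t) ?V"]) (auto intro!: finite_PiE)
  also have "\<dots> = (\<Prod>v\<in>?V. c (fst v) + 1)" by (simp add: card_PiE)
  also have "\<dots> = (\<Prod>i=1..m. \<Prod>j=1..r i. c i + 1)" by (subst prod.Sigma) (auto simp: case_prod_beta)
  finally show ?thesis by simp
qed

text \<open>
  The exponents of the last \<open>\<delta>\<close> variables may be chosen freely up to \<open>t\<close>, and the first variable makes up
  the degree. This crude count has the right order of growth in \<open>t\<close>.
\<close>
lemma card_target_monoms_ge: "(t + 1) ^ \<delta> \<le> card (monoms 1 (\<lambda>_. \<delta>) (\<lambda>_. \<delta> * t))"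
proof -
  let ?E = "PiE {1..\<delta>} (\<lambda>_. {..t})"
  define M :: "(nat \<Rightarrow> nat) \<Rightarrow> monom" where
    "M = (\<lambda>h. single (1, 0) (\<delta> * t - (\<Sum>j=1..\<delta>. h j)) + (\<Sum>j=1..\<delta>. single (1, j) (h j)))"
  have lookup: "lookup (M h) (i, j) = (if i = 1 \<and> j \<in> {1..\<delta>} then h j
      else if i = 1 \<and> j = 0 then \<delta> * t - (\<Sum>j=1..\<delta>. h j) else 0)" for h i j
  proof -
    have "lookup (\<Sum>k=1..\<delta>. single (1, k) (h k)) (i, j) = (\<Sum>k=1..\<delta>. if k = j then (if i = 1 then h k else 0) else 0)"
      by (auto simp: lookup_sum lookup_single when_def intro!: sum.cong)
    also have "\<dots> = (if i = 1 \<and> j \<in> {1..\<delta>} then h j else 0)" by simp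
    finally show ?thesis unfolding M_def by (auto simp: lookup_add lookup_single when_def)
  qed
  have "inj_on M ?E"
  proof (rule inj_onI)
    fix h h' assume h: "h \<in> ?E" "h' \<in> ?E" and eq: "M h = M h'"
    show "h = h'"
    proof (rule PiE_ext[OF h])
      fix j assume "j \<in> {1..\<delta>}"
      then show "h j = h' j" using arg_cong[OF eq, of "\<lambda>u. lookup u (1, j)"] by (simp add: lookup)
    qed
  qed
  moreover have "M ` ?E \<subseteq> monoms 1 (\<lambda>_. \<delta>) (\<lambda>_. \<delta> * t)"
  proof (rule image_subsetI)
    fix h assume h: "h \<in> ?E"
    have "(\<Sum>j=1..\<delta>. h j) \<le> (\<Sum>j=1..\<delta>. t)" using h by (intro sum_mono) (auto simp: PiE_iff)
    moreover have "(\<Sum>j=1..\<delta>. lookup (M h) (1, j)) = (\<Sum>j=1..\<delta>. h j)" by (intro sum.cong) (auto simp: lookup)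
    ultimately have "mdeg (\<lambda>_. \<delta>) (M h) 1 = \<delta> * t"
      unfolding mdeg_def by (simp add: sum.atLeast_Suc_atMost lookup)
    moreover have "keys (M h) \<subseteq> mvars 1 (\<lambda>_. \<delta>)"
      by (auto simp: in_keys_iff lookup mvars_def split: if_splits)
    ultimately show "M h \<in> monoms 1 (\<lambda>_. \<delta>) (\<lambda>_. \<delta> * t)" by (auto simp: monoms_def)
  qed
  ultimately have "card ?E \<le> card (monoms 1 (\<lambda>_. \<delta>) (\<lambda>_. \<delta> * t))"
    by (intro card_inj_on_le) auto
  then show ?thesis by (simp add: card_PiE)
qed

section \<open>The rank of a graded piece\<close>

text \<open>
  Families are used instead of sets, so repeated members count as dependent.
\<close>
lemma linear_dependence:
  fixes v :: "'b \<Rightarrow> 'a::field mpoly"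
  assumes T: "finite T" and M: "finite M" "card M < card T" and v: "\<And>x. x \<in> T \<Longrightarrow> keys (v x) \<subseteq> M"
  obtains a where "\<exists>x\<in>T. a x \<noteq> 0" "(\<Sum>x\<in>T. mp_const (a x) * v x) = 0"
proof -
  interpret vs: vector_space "\<lambda>c (p :: 'a mpoly). mp_const c * p"
    by unfold_locales (simp_all add: mp_const_add mp_const_mult algebra_simps)
  let ?B = "(\<lambda>u. single u 1 :: 'a mpoly) ` M"
  have span: "v ` T \<subseteq> vs.span ?B"
  proof (rule image_subsetI)
    fix x assume "x \<in> T"
    then have "v x = (\<Sum>u\<in>M. mp_const (lookup (v x) u) * single u 1)"
      using poly_mapping_eq_sum_single[OF M(1) v] by simp
    also have "\<dots> \<in> vs.span ?B"
      by (intro vs.span_sum vs.span_scale vs.span_base imageI)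
    finally show "v x \<in> vs.span ?B" .
  qed
  show ?thesis
  proof (cases "inj_on v T")
    case True
    have "vs.dependent (v ` T)"
    proof (rule ccontr)
      assume "\<not> vs.dependent (v ` T)"
      with span M(1) have "card (v ` T) \<le> card ?B"
        using vs.independent_span_bound[of ?B "v ` T"] by auto
      also have "\<dots> \<le> card M" using M(1) by (rule card_image_le)
      finally show False using M(2) True by (simp add: card_image)
    qed
    then obtain u where u: "\<exists>w\<in>v ` T. u w \<noteq> 0" "(\<Sum>w\<in>v ` T. mp_const (u w) * w) = 0"
      using vs.dependent_finite[of "v ` T"] T by auto
    then show ?thesis using that[of "\<lambda>x. u (v x)"] True by (auto simp: sum.reindex)
  next
    case False
    then obtain x y where xy: "x \<in> T" "y \<in> T" "x \<noteq> y" "v x = v y" by (auto simp: inj_on_def)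
    have "(\<Sum>z\<in>T. mp_const (if z = x then 1 else if z = y then - 1 else 0) * v z)
        = (\<Sum>z\<in>T. (if z = x then v x else 0) - (if z = y then v y else 0))"
      using xy(3) vs.scale_minus_left[of 1] by (intro sum.cong) auto
    also have "\<dots> = 0" using T xy by (simp add: sum_subtractf)
    finally show ?thesis
      using that[of "\<lambda>z. if z = x then 1 else if z = y then - 1 else 0"] xy(1) by force
  qed
qed

text \<open>
  Linear independence over \<open>A\<close>, with coefficients restricted to forms of a common degree. With this
  restriction the notion stays meaningful when \<open>d = 0\<close> and forms of different degrees have pullbacks in the
  same graded piece.
\<close>
definition graded_independent ::
  "(nat \<Rightarrow> 'a::field mpoly) \<Rightarrow> nat \<Rightarrow> nat \<Rightarrow> (nat \<Rightarrow> 'a mpoly) \<Rightarrow> bool" where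
  "graded_independent f \<delta> \<rho> e \<longleftrightarrow>
     (\<forall>N \<alpha>. (\<forall>l<\<rho>. \<alpha> l \<in> target_forms \<delta> N) \<and> (\<Sum>l<\<rho>. pullback f (\<alpha> l) * e l) = 0
        \<longrightarrow> (\<forall>l<\<rho>. \<alpha> l = 0))"

text \<open>
  The products of the \<open>e l\<close> with the pulled back monomials of degree \<open>N\<close> are linearly independent over the
  base field and lie in a single graded piece.
\<close>
lemma independent_count:
  fixes f :: "nat \<Rightarrow> 'a::field mpoly"
  assumes f: "\<forall>j\<in>{0..\<delta>}. f j \<in> graded_comp m r d"
    and e: "\<And>l. l < \<rho> \<Longrightarrow> e l \<in> graded_comp m r c" and ind: "graded_independent f \<delta> \<rho> e"
  shows "\<rho> * card (monoms 1 (\<lambda>_. \<delta>) (\<lambda>_. N)) \<le> card (monoms m r (\<lambda>i. N * d i + c i))"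
proof (rule ccontr)
  let ?U = "monoms 1 (\<lambda>_. \<delta>) (\<lambda>_. N)"
  let ?v = "\<lambda>(l, u). pullback f (single u 1) * e l"
  assume "\<not> ?thesis"
  then have small: "card (monoms m r (\<lambda>i. N * d i + c i)) < card ({..<\<rho>} \<times> ?U)"
    by (simp add: card_cartesian_product)
  have keys: "keys (?v x) \<subseteq> monoms m r (\<lambda>i. N * d i + c i)" if xT: "x \<in> {..<\<rho>} \<times> ?U" for x
  proof -
    obtain l u where x: "x = (l, u)" "l < \<rho>" "u \<in> ?U" using xT by blast
    from graded_comp_mult[OF pullback_graded[OF f graded_comp_single[OF x(3)]] e[OF x(2)]]
    show ?thesis by (simp only: graded_comp_iff x(1) prod.case)
  qed
  have "finite ({..<\<rho>} \<times> ?U)" by simp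
  then obtain a where a: "\<exists>x\<in>{..<\<rho>} \<times> ?U. a x \<noteq> 0"
    "(\<Sum>x\<in>{..<\<rho>} \<times> ?U. mp_const (a x) * ?v x) = 0"
    using linear_dependence[where v = ?v, OF _ finite_monoms small keys] by blast
  define \<alpha> where "\<alpha> = (\<lambda>l. \<Sum>u\<in>?U. single u (a (l, u)))"
  have \<alpha>: "\<alpha> l \<in> target_forms \<delta> N" for l
    unfolding \<alpha>_def by (intro graded_comp_sum graded_comp_single)
  have "(\<Sum>l<\<rho>. pullback f (\<alpha> l) * e l) = (\<Sum>l<\<rho>. \<Sum>u\<in>?U. mp_const (a (l, u)) * (pullback f (single u 1) * e l))"
    by (simp add: \<alpha>_def mp_subst_sum sum_distrib_right mult.assoc)
  also have "\<dots> = 0" using a(2) by (simp add: sum.cartesian_product case_prod_beta)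
  finally have "\<forall>l<\<rho>. \<alpha> l = 0" using ind \<alpha> unfolding graded_independent_def by blast
  moreover have "lookup (\<alpha> l) u = a (l, u)" if "u \<in> ?U" for l u
  proof -
    have "lookup (\<alpha> l) u = (\<Sum>w\<in>?U. if w = u then a (l, w) else 0)"
      unfolding \<alpha>_def by (auto simp: lookup_sum lookup_single when_def intro!: sum.cong)
    with that show ?thesis by simp
  qed
  moreover obtain l u where "l < \<rho>" "u \<in> ?U" "a (l, u) \<noteq> 0" using a(1) by blast
  ultimately show False by (metis lookup_zero)
qed

text \<open>
  In the previous estimate the number of forms on the left grows like \<open>N\<^sup>\<delta>\<close>, the right side grows at most
  like \<open>N\<^sup>\<delta>\<close>, and the degree \<open>c\<close> influences only lower order terms. The bound is therefore independent of \<open>c\<close>, which makes a family of maximal size over all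
  degrees exist.
\<close>
lemma independent_bound:
  fixes f :: "nat \<Rightarrow> 'a::field mpoly"
  assumes f: "\<forall>j\<in>{0..\<delta>}. f j \<in> graded_comp m r d"
    and \<delta>: "(\<Sum>i=1..m. r i) = \<delta>"
    and e: "\<And>l. l < \<rho> \<Longrightarrow> e l \<in> graded_comp m r c" and ind: "graded_independent f \<delta> \<rho> e"
  shows "\<rho> \<le> (\<Prod>i=1..m. (\<delta> * d i + 1) ^ r i)"
proof -
  \<comment> \<open>The comparison is made in degree \<open>N = \<delta> t\<close>, and any \<open>t\<close> with \<open>c i \<le> t\<close> for all \<open>i\<close> will do: then
     \<open>\<delta> t d i + c i + 1 \<le> (t + 1) (\<delta> d i + 1)\<close>, and the powers of \<open>t + 1\<close> cancel.\<close>
  define t where "t = (\<Sum>i=1..m. c i)"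
  have "\<rho> * (t + 1) ^ \<delta> \<le> \<rho> * card (monoms 1 (\<lambda>_. \<delta>) (\<lambda>_. \<delta> * t))"
    by (intro mult_left_mono card_target_monoms_ge) simp
  also have "\<dots> \<le> card (monoms m r (\<lambda>i. \<delta> * t * d i + c i))"
    by (rule independent_count[OF f e ind])
  also have "\<dots> \<le> (\<Prod>i=1..m. (\<delta> * t * d i + c i + 1) ^ r i)"
    by (rule card_monoms_le)
  also have "\<dots> \<le> (\<Prod>i=1..m. ((t + 1) * (\<delta> * d i + 1)) ^ r i)"
  proof (intro prod_mono conjI power_mono)
    fix i assume "i \<in> {1..m}"
    then have "c i \<le> t" unfolding t_def by (intro member_le_sum) auto
    then show "\<delta> * t * d i + c i + 1 \<le> (t + 1) * (\<delta> * d i + 1)" by (simp add: algebra_simps)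
  qed simp_all
  also have "\<dots> = (\<Prod>i=1..m. (\<delta> * d i + 1) ^ r i) * (t + 1) ^ \<delta>"
    unfolding power_mult_distrib prod.distrib power_sum[symmetric] \<delta> by simp
  finally show ?thesis by simp
qed

section \<open>Constructing the inverse\<close>

lemma lookup_single_mult:
  fixes p :: "'a::comm_semiring_1 mpoly"
  shows "lookup (single u 1 * p) (u + t) = lookup p t"
proof -
  have "keys p \<subseteq> UNIV" by simp
  then show ?thesis
    by (induction p rule: mpoly_induct_keys)
       (auto simp: mult_single lookup_single when_def distrib_left lookup_add)
qed

lemma graded_comp_cancel_var:
  fixes h :: "'a::field mpoly"
  assumes v: "v \<in> mvars m r"
    and vh: "mp_var v * h \<in> graded_comp m r (\<lambda>k. c k + (if k = fst v then 1 else 0))"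
  shows "h \<in> graded_comp m r c"
  unfolding graded_comp_iff
proof
  fix t assume "t \<in> keys h"
  then have "single v 1 + t \<in> keys (mp_var v * h)"
    by (simp add: in_keys_iff mp_var_def lookup_single_mult)
  with vh have "single v 1 + t \<in> monoms m r (\<lambda>k. c k + (if k = fst v then 1 else 0))"
    by (auto simp: graded_comp_iff)
  moreover have "keys t \<subseteq> keys (single v 1 + t)" by (auto simp: in_keys_iff lookup_add)
  moreover have "mdeg r (single v 1) k = (if k = fst v then 1 else 0)" for k
    using v by (cases v) (auto simp: mdeg_single_var mvars_def)
  ultimately show "t \<in> monoms m r c" by (auto simp: monoms_def mdeg_add)
qed

lemma divisible_by_var:
  fixes p :: "'a::field mpoly"
  assumes "\<And>t. t \<in> keys p \<Longrightarrow> lookup t v > 0"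
  shows "mp_var v dvd p"
proof -
  have "keys p \<subseteq> {t. lookup t v > 0}" using assms by auto
  then show ?thesis
  proof (induction p rule: mpoly_induct_keys)
    case (single t a)
    then obtain w where "t = single v 1 + w" using monom_split_var by blast
    then have "single t a = mp_var v * single w a" by (simp add: mp_var_def mult_single)
    then show ?case by simp
  qed auto
qed

text \<open>
  The family is maximal among the families in all graded pieces, not only in its own. This lets one
  compare the piece of degree \<open>c\<close> with the next one.
\<close>
lemma maximal_independent_family:
  fixes f :: "nat \<Rightarrow> 'a::field mpoly"
  assumes f: "\<forall>j\<in>{0..\<delta>}. f j \<in> graded_comp m r d"
    and \<delta>: "(\<Sum>i=1..m. r i) = \<delta>"
  obtains \<rho> c e where "\<And>l. l < \<rho> \<Longrightarrow> e l \<in> graded_comp m r c" "graded_independent f \<delta> \<rho> e"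
    "\<And>c' e'. (\<And>l. l < Suc \<rho> \<Longrightarrow> e' l \<in> graded_comp m r c') \<Longrightarrow> \<not> graded_independent f \<delta> (Suc \<rho>) e'"
proof -
  define P where "P = (\<lambda>\<rho>. \<exists>c e. (\<forall>l<\<rho>. e l \<in> graded_comp m r c) \<and> graded_independent f \<delta> \<rho> e)"
  have "P 0" by (simp add: P_def graded_independent_def)
  have bound: "\<rho> \<le> (\<Prod>i=1..m. (\<delta> * d i + 1) ^ r i)" if "P \<rho>" for \<rho>
    using that independent_bound[OF f \<delta>] unfolding P_def by blast
  define \<rho> where "\<rho> = (GREATEST \<rho>. P \<rho>)"
  have "P \<rho>" unfolding \<rho>_def by (rule GreatestI_nat[where P = P, OF \<open>P 0\<close> bound])
  moreover have "\<not> P (Suc \<rho>)"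
  proof
    assume "P (Suc \<rho>)"
    then have "Suc \<rho> \<le> \<rho>" unfolding \<rho>_def by (rule Greatest_le_nat[where P = P, OF _ bound])
    then show False by simp
  qed
  ultimately obtain c e where "\<forall>l<\<rho>. e l \<in> graded_comp m r c" "graded_independent f \<delta> \<rho> e"
    and "\<And>c' e'. \<forall>l<Suc \<rho>. e' l \<in> graded_comp m r c' \<Longrightarrow> \<not> graded_independent f \<delta> (Suc \<rho>) e'"
    unfolding P_def by blast
  then show ?thesis by (intro that[of \<rho> e c]) blast+
qed

text \<open>
  Let \<open>c\<close> be a degree in which the rank is maximal. After multiplication by \<open>x\<^sub>i\<^sub>,\<^sub>0\<close> a maximal family is still
  maximal in the piece that contains the products \<open>x\<^sub>i\<^sub>,\<^sub>j R\<^sub>c\<close>, so each of these products has a nonzero multiple in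
  \<open>x\<^sub>i\<^sub>,\<^sub>0 R\<^sub>c A\<close>; multiplying the finitely many denominators gives one form \<open>\<alpha>\<close> for all of them. Then
  \<open>h = \<phi>(\<alpha>) x\<^sub>i\<^sub>,\<^sub>j / x\<^sub>i\<^sub>,\<^sub>0\<close> maps \<open>R\<^sub>c\<close> into \<open>R\<^sub>c A\<^sub>N\<close>, and saturation turns \<open>h\<close> into a pulled back form.
\<close>
lemma saturated_imp_proportional:
  fixes f :: "nat \<Rightarrow> 'a::field mpoly"
  assumes f: "\<forall>j\<in>{0..\<delta>}. f j \<in> graded_comp m r d"
    and \<delta>: "(\<Sum>i=1..m. r i) = \<delta>"
    and I: "I = Idl\<^bsub>coord_ring m r\<^esub> (f ` {0..\<delta>})"
    and sat: "\<And>n. n \<ge> 1 \<Longrightarrow> ideal_comp m r (ideal_pow m r I n) (\<lambda>i. n * d i) =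
      ideal_comp m r (saturation m r (ideal_pow m r I n)) (\<lambda>i. n * d i)"
    and i: "i \<in> {1..m}"
  obtains N g where "\<And>j. j \<le> r i \<Longrightarrow> g j \<in> target_forms \<delta> N" "g 0 \<noteq> 0"
    "\<And>j. j \<le> r i \<Longrightarrow> pullback f (g j) * mp_var (i, 0) = pullback f (g 0) * mp_var (i, j)"
proof -
  obtain \<rho> c e where e: "\<And>l. l < \<rho> \<Longrightarrow> e l \<in> graded_comp m r c" and ind: "graded_independent f \<delta> \<rho> e"
    and max: "\<And>c' e'. (\<And>l. l < Suc \<rho> \<Longrightarrow> e' l \<in> graded_comp m r c') \<Longrightarrow> \<not> graded_independent f \<delta> (Suc \<rho>) e'"
    using maximal_independent_family[OF f \<delta>] by metis
  let ?x = "\<lambda>j. mp_var (i, j) :: 'a mpoly"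
  let ?S = "\<lambda>N. add_span (form_products f \<delta> (graded_comp m r c) N)"
  define c' where "c' = (\<lambda>k. c k + (if k = i then 1 else 0))"
  have xR: "?x j * p \<in> graded_comp m r c'" if "j \<le> r i" "p \<in> graded_comp m r c" for j p
  proof -
    have "(i, j) \<in> mvars m r" using i that by (auto simp: mvars_def)
    from graded_comp_mult[OF that(2) graded_comp_var[OF this]] show ?thesis
      by (simp add: c'_def mult.commute)
  qed
  have one: "\<exists>N. \<exists>\<alpha>\<in>target_forms \<delta> N. \<alpha> \<noteq> 0 \<and> (\<exists>y\<in>?S N. pullback f \<alpha> * q = ?x 0 * y)"
    if q: "q \<in> graded_comp m r c'" for q
  proof -
    \<comment> \<open>One member more than the maximal number, so there is a relation; the coefficient of \<open>q\<close>
       in it cannot vanish, since the other members are independent.\<close>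
    define e' where "e' = (\<lambda>l. if l < \<rho> then ?x 0 * e l else q)"
    have "e' l \<in> graded_comp m r c'" for l unfolding e'_def using q xR e by auto
    then have "\<not> graded_independent f \<delta> (Suc \<rho>) e'" by (intro max)
    then obtain N \<alpha> where \<alpha>: "\<And>l. l < Suc \<rho> \<Longrightarrow> \<alpha> l \<in> target_forms \<delta> N"
      "(\<Sum>l<Suc \<rho>. pullback f (\<alpha> l) * e' l) = 0" "\<exists>l<Suc \<rho>. \<alpha> l \<noteq> 0"
      unfolding graded_independent_def by blast
    have "(\<Sum>l<\<rho>. pullback f (\<alpha> l) * e' l) = ?x 0 * (\<Sum>l<\<rho>. pullback f (\<alpha> l) * e l)"
      by (simp add: e'_def sum_distrib_left mult_ac)
    with \<alpha>(2) have sum: "?x 0 * (\<Sum>l<\<rho>. pullback f (\<alpha> l) * e l) + pullback f (\<alpha> \<rho>) * q = 0"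
      by (simp add: e'_def)
    have nz: "\<alpha> \<rho> \<noteq> 0"
    proof
      assume 0: "\<alpha> \<rho> = 0"
      with sum have "(\<Sum>l<\<rho>. pullback f (\<alpha> l) * e l) = 0" by simp
      moreover have "\<forall>l<\<rho>. \<alpha> l \<in> target_forms \<delta> N" using \<alpha>(1) by simp
      ultimately have "\<forall>l<\<rho>. \<alpha> l = 0" using ind unfolding graded_independent_def by blast
      with 0 \<alpha>(3) show False by (auto simp: less_Suc_eq)
    qed
    define y where "y = (\<Sum>l<\<rho>. e l * pullback f (- \<alpha> l))"
    have "y \<in> ?S N"
      unfolding y_def form_products_def
    proof (intro add_span_sum add_span_base CollectI exI conjI)
      fix l assume "l \<in> {..<\<rho>}"
      then show "e l \<in> graded_comp m r c" "- \<alpha> l \<in> target_forms \<delta> N"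
        using e \<alpha>(1) by (auto intro: graded_comp_uminus)
    qed simp
    moreover have "pullback f (\<alpha> \<rho>) * q = ?x 0 * y"
    proof -
      have "y = - (\<Sum>l<\<rho>. pullback f (\<alpha> l) * e l)"
        by (simp add: y_def mp_subst_uminus sum_negf mult.commute)
      then have "?x 0 * y = - (?x 0 * (\<Sum>l<\<rho>. pullback f (\<alpha> l) * e l))" by simp
      moreover have "pullback f (\<alpha> \<rho>) * q = - (?x 0 * (\<Sum>l<\<rho>. pullback f (\<alpha> l) * e l))"
        unfolding eq_neg_iff_add_eq_0 using sum by (simp only: add.commute)
      ultimately show ?thesis by simp
    qed
    ultimately show ?thesis using nz \<alpha>(1)[of \<rho>] by blast
  qed
  have many: "\<exists>N\<ge>1. \<exists>\<alpha>\<in>target_forms \<delta> N. \<alpha> \<noteq> 0 \<and> (\<forall>q\<in>Q. \<exists>y\<in>?S N. pullback f \<alpha> * q = ?x 0 * y)"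
    if "finite Q" "Q \<subseteq> graded_comp m r c'" for Q
    using that
  proof (induction Q rule: finite_induct)
    case empty
    \<comment> \<open>Starting from a coordinate instead of \<open>1\<close> makes the final degree positive, as the
       saturation hypothesis concerns \<open>n \<ge> 1\<close> only.\<close>
    have "mp_var (1, 0) \<in> target_forms \<delta> 1" by (rule target_forms_var) simp
    then show ?case using mp_var_nonzero[of "(1, 0)"] by (intro exI[of _ 1]) blast
  next
    case (insert q Q)
    then obtain N \<alpha> where \<alpha>: "N \<ge> 1" "\<alpha> \<in> target_forms \<delta> N" "\<alpha> \<noteq> 0"
      "\<forall>q\<in>Q. \<exists>y\<in>?S N. pullback f \<alpha> * q = ?x 0 * y" by auto
    obtain K \<beta> y0 where \<beta>: "\<beta> \<in> target_forms \<delta> K" "\<beta> \<noteq> 0" "y0 \<in> ?S K" "pullback f \<beta> * q = ?x 0 * y0"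
      using one[of q] insert.prems by blast
    have "\<exists>y\<in>?S (N + K). pullback f (\<alpha> * \<beta>) * q' = ?x 0 * y" if "q' \<in> insert q Q" for q'
    proof (cases "q' = q")
      case True
      have "pullback f (\<alpha> * \<beta>) * q' = pullback f \<alpha> * (pullback f \<beta> * q)"
        by (simp add: True mp_subst_mult mult_ac)
      also have "\<dots> = ?x 0 * (y0 * pullback f \<alpha>)" unfolding \<beta>(4) by (simp add: mult_ac)
      finally show ?thesis using form_products_mult[OF \<beta>(3) \<alpha>(2)] by (auto simp: add.commute)
    next
      case False
      with that \<alpha>(4) obtain y where y: "y \<in> ?S N" "pullback f \<alpha> * q' = ?x 0 * y" by blast
      have "pullback f (\<alpha> * \<beta>) * q' = pullback f \<beta> * (pullback f \<alpha> * q')"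
        by (simp add: mp_subst_mult mult_ac)
      also have "\<dots> = ?x 0 * (y * pullback f \<beta>)" unfolding y(2) by (simp add: mult_ac)
      finally show ?thesis using form_products_mult[OF y(1) \<beta>(1)] by auto
    qed
    moreover have "\<alpha> * \<beta> \<noteq> 0" using \<alpha>(3) \<beta>(2) by simp
    moreover have "\<alpha> * \<beta> \<in> target_forms \<delta> (N + K)" using \<alpha>(2) \<beta>(1) by (rule target_forms_mult)
    moreover have "N + K \<ge> 1" using \<alpha>(1) by simp
    ultimately show ?case by blast
  qed
  let ?Q = "(\<lambda>(j, u). ?x j * single u 1) ` ({..r i} \<times> monoms m r c)"
  have "?Q \<subseteq> graded_comp m r c'" by (auto intro!: xR graded_comp_single)
  then obtain N \<alpha> where N: "N \<ge> 1" and \<alpha>: "\<alpha> \<in> target_forms \<delta> N" "\<alpha> \<noteq> 0"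
    and Q: "\<forall>q\<in>?Q. \<exists>y\<in>?S N. pullback f \<alpha> * q = ?x 0 * y"
    using many[of ?Q] by auto
  have all: "\<exists>y\<in>?S N. pullback f \<alpha> * (?x j * p) = ?x 0 * y" if j: "j \<le> r i" and p: "p \<in> graded_comp m r c" for j p
  proof -
    have "keys p \<subseteq> monoms m r c" using p by (simp add: graded_comp_iff)
    then show ?thesis
    proof (induction p rule: mpoly_induct_keys)
      case zero
      show ?case by (intro bexI[of _ 0] add_span.zero) simp
    next
      case (single t a)
      then obtain y where y: "y \<in> ?S N" "pullback f \<alpha> * (?x j * single t 1) = ?x 0 * y" using Q j by fastforce
      have "single t a = single t 1 * mp_const a" by (simp add: mp_const_def mult_single)
      then have "pullback f \<alpha> * (?x j * single t a) = (pullback f \<alpha> * (?x j * single t 1)) * mp_const a"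
        by (simp only: mult.assoc)
      also have "\<dots> = ?x 0 * (y * pullback f (mp_const a))" by (simp add: y(2) mult.assoc)
      finally show ?case using form_products_mult[OF y(1) graded_comp_const[of a]] by auto
    next
      case (add p q)
      then obtain y z where "y \<in> ?S N" "pullback f \<alpha> * (?x j * p) = ?x 0 * y"
        "z \<in> ?S N" "pullback f \<alpha> * (?x j * q) = ?x 0 * z" by blast
      then show ?case by (intro bexI[of _ "y + z"] add_span_add) (auto simp: distrib_left)
    qed
  qed
  have "\<exists>\<eta>\<in>target_forms \<delta> N. pullback f \<eta> * ?x 0 = pullback f \<alpha> * ?x j" if j: "j \<le> r i" "j \<noteq> 0" for j
  proof -
    \<comment> \<open>A monomial of degree \<open>c\<close> without the variable \<open>x\<^sub>i\<^sub>,\<^sub>0\<close>; it shows that \<open>x\<^sub>i\<^sub>,\<^sub>0\<close> divides \<open>\<phi>(\<alpha>)\<close>.\<close>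
    define u where "u = (\<Sum>k=1..m. single (k, if k = i then j else 0) (c k) :: monom)"
    have u: "u \<in> monoms m r c"
    proof -
      have "keys u \<subseteq> mvars m r"
        unfolding u_def using j by (intro order_trans[OF Poly_Mapping.keys_sum]) (auto simp: mvars_def split: if_splits)
      moreover have "mdeg r u k = c k" if "k \<in> {1..m}" for k
      proof -
        have "mdeg r u k = (\<Sum>k'=1..m. mdeg r (single (k', if k' = i then j else 0) (c k')) k)"
          unfolding u_def mdeg_def lookup_sum by (rule sum.swap)
        also have "\<dots> = (\<Sum>k'=1..m. if k' = k then c k else 0)"
          using j by (intro sum.cong) (auto simp: mdeg_single_var)
        finally show ?thesis using that by simp
      qed
      ultimately show ?thesis by (auto simp: monoms_def)
    qed
    have u0: "lookup (single (i, j) 1 + u) (i, 0) = 0"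
      unfolding u_def using j by (auto simp: lookup_add lookup_sum lookup_single when_def intro!: sum.neutral)
    obtain y where y: "pullback f \<alpha> * (?x j * single u 1) = ?x 0 * y"
      using all[OF j(1) graded_comp_single[OF u]] by blast
    have "?x 0 dvd pullback f \<alpha>"
    proof (rule divisible_by_var)
      fix t assume "t \<in> keys (pullback f \<alpha>)"
      then have "(single (i, j) 1 + u) + t \<in> keys (single (single (i, j) 1 + u) 1 * pullback f \<alpha>)"
        by (simp only: in_keys_iff lookup_single_mult) simp
      also have "single (single (i, j) 1 + u) 1 * pullback f \<alpha> = ?x 0 * y"
        unfolding y[symmetric] by (simp add: mp_var_def mult_single mult.commute add.commute)
      finally obtain w where "(single (i, j) 1 + u) + t = single (i, 0) 1 + w"
        using keys_mult[of "?x 0" y] by (auto simp: mp_var_def)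
      then have "lookup ((single (i, j) 1 + u) + t) (i, 0) > 0" by (simp add: lookup_add)
      with u0 show "lookup t (i, 0) > 0" by (simp add: lookup_add)
    qed
    then obtain a where a: "pullback f \<alpha> = ?x 0 * a" by (auto elim: dvdE)
    define h where "h = a * ?x j"
    have xh: "?x 0 * h = pullback f \<alpha> * ?x j" by (simp add: h_def a mult.assoc)
    have v: "(i, 0) \<in> mvars m r" "(i, j) \<in> mvars m r" using i j by (auto simp: mvars_def)
    have "?x 0 * h \<in> graded_comp m r (\<lambda>k. N * d k + (if k = fst (i, 0::nat) then 1 else 0))"
      using graded_comp_mult[OF pullback_graded[OF f \<alpha>(1)] graded_comp_var[OF v(2)]] by (simp add: xh)
    then have h: "h \<in> graded_comp m r (\<lambda>k. N * d k)" by (rule graded_comp_cancel_var[OF v(1)])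
    have "h \<in> saturation m r (ideal_pow m r I N)"
    proof (rule multiplier_in_saturation[OF f I graded_comp_carrier[OF h]])
      fix p :: "'a mpoly"
      assume p: "p \<in> graded_comp m r c"
      obtain y where y: "y \<in> ?S N" "pullback f \<alpha> * (?x j * p) = ?x 0 * y" using all[OF j(1) p] by blast
      have "?x 0 * (h * p) = ?x 0 * y" using y(2) xh by (simp add: mult.assoc[symmetric])
      then have "h * p = y" by simp
      with y(1) show "h * p \<in> ?S N" by simp
    qed
    with h have "h \<in> ideal_comp m r (ideal_pow m r I N) (\<lambda>i. N * d i)"
      unfolding sat[OF N] by (simp add: ideal_comp_def)
    then obtain \<eta> where "\<eta> \<in> target_forms \<delta> N" "h = pullback f \<eta>"
      unfolding ideal_comp_pow_eq_pullbacks[OF f I] by blast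
    with xh show ?thesis by (auto simp: mult.commute)
  qed
  then obtain g where g: "\<And>j. j \<le> r i \<Longrightarrow> j \<noteq> 0 \<Longrightarrow> g j \<in> target_forms \<delta> N \<and> pullback f (g j) * ?x 0 = pullback f \<alpha> * ?x j"
    by metis
  show ?thesis
    by (rule that[of "g(0 := \<alpha>)" N]) (use g \<alpha> in auto)
qed

text \<open>
  The forms found for the separate factors are the components of the inverse. That the other composite
  is the identity of the target may be checked after pullback, by graded injectivity, where it follows from
  the first composite being the identity.
\<close>
lemma saturated_imp_birational:
  fixes f :: "nat \<Rightarrow> 'a::field mpoly"
  assumes f: "\<forall>j\<in>{0..\<delta>}. f j \<in> graded_comp m r d"
    and \<delta>: "(\<Sum>i=1..m. r i) = \<delta>"
    and I: "I = Idl\<^bsub>coord_ring m r\<^esub> (f ` {0..\<delta>})"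
    and inj: "\<And>n \<alpha>. \<alpha> \<in> target_forms \<delta> n \<Longrightarrow> pullback f \<alpha> = 0 \<Longrightarrow> \<alpha> = 0"
    and rf: "rational_map m r 1 (\<lambda>_. \<delta>) (to_proj f)"
    and dom: "dominant m r 1 (\<lambda>_. \<delta>) (to_proj f)"
    and sat: "\<And>n. n \<ge> 1 \<Longrightarrow> ideal_comp m r (ideal_pow m r I n) (\<lambda>i. n * d i) =
      ideal_comp m r (saturation m r (ideal_pow m r I n)) (\<lambda>i. n * d i)"
  shows "birational m r 1 (\<lambda>_. \<delta>) (to_proj f)"
proof -
  have "\<exists>N g. (\<forall>j\<le>r i. g j \<in> target_forms \<delta> N) \<and> g 0 \<noteq> 0 \<and>
      (\<forall>j\<le>r i. pullback f (g j) * mp_var (i, 0) = pullback f (g 0) * mp_var (i, j))"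
    if "i \<in> {1..m}" for i
    using saturated_imp_proportional[OF f \<delta> I sat that] by metis
  then obtain N g where Ng: "\<And>i. i \<in> {1..m} \<Longrightarrow> (\<forall>j\<le>r i. g i j \<in> target_forms \<delta> (N i)) \<and> g i 0 \<noteq> 0 \<and>
      (\<forall>j\<le>r i. pullback f (g i j) * mp_var (i, 0) = pullback f (g i 0) * mp_var (i, j))"
    by metis
  define g' where "g' = (\<lambda>(i, j). g i j)"
  let ?G = "\<lambda>v. pullback f (g' v)"
  have g': "g' (i, j) \<in> target_forms \<delta> (N i)" if "i \<in> {1..m}" "j \<le> r i" for i j
    using Ng that by (simp add: g'_def)
  have G: "?G (i, j) * mp_var (i, 0) = ?G (i, 0) * mp_var (i, j)" if "i \<in> {1..m}" "j \<le> r i" for i j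
    using Ng that by (simp add: g'_def)
  have g0: "g' (i, 0) \<noteq> 0" if "i \<in> {1..m}" for i using Ng that by (simp add: g'_def)
  have G0: "?G (i, 0) \<noteq> 0" if "i \<in> {1..m}" for i using inj g0[OF that] g'[OF that, of 0] by blast
  from rf obtain j0 where j0: "j0 \<le> \<delta>" "f j0 \<noteq> 0" by (auto simp: rational_map_def)
  have fj: "f j \<in> graded_comp m r d" if "j \<le> \<delta>" for j using f that by auto
  have comp: "pullback f (mp_subst g' p) = mp_subst ?G p" for p by (rule mp_subst_mp_subst)
  define K where "K = (\<Sum>i=1..m. d i * N i)"
  have gf: "mp_subst g' (f j) \<in> target_forms \<delta> K" if "j \<le> \<delta>" for j
    unfolding K_def using mp_subst_graded[of m r g' 1 "\<lambda>_. \<delta>" "\<lambda>i _. N i", OF g' fj[OF that]] .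
  show ?thesis
    unfolding birational_def
  proof (intro conjI exI[of _ g'] rf dom)
    show "rational_map 1 (\<lambda>_. \<delta>) m r g'"
      unfolding rational_map_def using g' g0 by (metis atLeastAtMost_iff le0)
    show "rational_map m r m r ?G"
      unfolding rational_map_def
    proof (intro ballI conjI)
      fix i assume i: "i \<in> {1..m}"
      show "\<exists>c. \<forall>j\<in>{0..r i}. ?G (i, j) \<in> graded_comp m r c"
        using pullback_graded[OF f g'[OF i]] by (intro exI[of _ "\<lambda>k. N i * d k"]) auto
      show "\<exists>j\<in>{0..r i}. ?G (i, j) \<noteq> 0" using G0[OF i] by auto
    qed
    show "same_rational_map m r ?G mp_var"
      unfolding same_rational_map_def
    proof (intro ballI)
      fix i j l assume ijl: "i \<in> {1..m}" "j \<in> {0..r i}" "l \<in> {0..r i}"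
      have "(?G (i, j) * mp_var (i, l)) * mp_var (i, 0) = (?G (i, j) * mp_var (i, 0)) * mp_var (i, l)"
        by (simp only: mult_ac)
      also have "\<dots> = (?G (i, 0) * mp_var (i, l)) * mp_var (i, j)" using G ijl by (simp add: mult_ac)
      also have "\<dots> = (?G (i, l) * mp_var (i, j)) * mp_var (i, 0)"
        using G[of i l, symmetric] ijl by (simp add: mult_ac)
      finally show "?G (i, j) * mp_var (i, l) = ?G (i, l) * mp_var (i, j)" by simp
    qed
    show "rational_map 1 (\<lambda>_. \<delta>) 1 (\<lambda>_. \<delta>) (\<lambda>v. mp_subst g' (to_proj f v))"
    proof -
      have "mp_subst g' (f j0) \<noteq> 0"
        using proportional_subst_nonzero[where G = ?G, OF G G0 fj[OF j0(1)] j0(2)]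
        unfolding comp[symmetric] by auto
      with gf j0(1) show ?thesis
        unfolding rational_map_def by (auto intro!: exI[of _ "\<lambda>_. K"])
    qed
    show "same_rational_map 1 (\<lambda>_. \<delta>) (\<lambda>v. mp_subst g' (to_proj f v)) mp_var"
      unfolding same_rational_map_def
    proof (intro ballI)
      fix i j l :: nat assume "i \<in> {1..1}" and "j \<in> {0..\<delta>}" "l \<in> {0..\<delta>}"
      then have i: "i = 1" and j: "j \<le> \<delta>" and l: "l \<le> \<delta>" by auto
      have "mp_subst ?G (f j) * f l = f j * mp_subst ?G (f l)"
        using proportional_subst_swap[where G = ?G, OF G G0 fj[OF j] fj[OF l]] by simp
      then have "pullback f (mp_subst g' (f j) * mp_var (1, l) - mp_subst g' (f l) * mp_var (1, j)) = 0"
        by (simp add: mp_subst_diff mp_subst_mult comp mult.commute)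
      moreover have "mp_subst g' (f j) * mp_var (1, l) - mp_subst g' (f l) * mp_var (1, j) \<in> target_forms \<delta> (K + 1)"
        by (intro graded_comp_diff target_forms_mult gf j l target_forms_var)
      ultimately show "mp_subst g' (to_proj f (i, j)) * mp_var (i, l) = mp_subst g' (to_proj f (i, l)) * mp_var (i, j)"
        using inj by (fastforce simp: i)
    qed
  qed
qed

theorem proposition3p12:
  fixes f :: "nat \<Rightarrow> 'a::field mpoly"
    and r d :: "nat \<Rightarrow> nat"
    and m \<delta> :: nat
    and I :: "'a mpoly set"
  assumes "m \<ge> 1"
    and "(\<Sum>i=1..m. r i) = \<delta>"
    and "\<forall>j\<in>{0..\<delta>}. f j \<in> graded_comp m r d"
    and "rational_map m r 1 (\<lambda>_. \<delta>) (to_proj f)"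
    and "dominant m r 1 (\<lambda>_. \<delta>) (to_proj f)"
    and "I = Idl\<^bsub>coord_ring m r\<^esub> (f ` {0..\<delta>})"
  shows "birational m r 1 (\<lambda>_. \<delta>) (to_proj f) \<longleftrightarrow>
    (\<forall>n\<ge>1. ideal_comp m r (ideal_pow m r I n) (\<lambda>i. n * d i) =
            ideal_comp m r (saturation m r (ideal_pow m r I n)) (\<lambda>i. n * d i))"
proof -
  note f = assms(3) and I = assms(6)
  have inj: "\<alpha> = 0" if "\<alpha> \<in> target_forms \<delta> n" "pullback f \<alpha> = 0" for n \<alpha>
    using dominant_imp_graded_injective[OF f assms(5) that] .
  show ?thesis
  proof
    assume bir: "birational m r 1 (\<lambda>_. \<delta>) (to_proj f)"
    interpret cring "coord_ring m r :: 'a mpoly ring" by (rule coord_ring_cring)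
    have "ideal I (coord_ring m r)"
      unfolding I using f by (intro genideal_ideal) (auto intro: graded_comp_carrier)
    note sub = ideal_comp_subset_saturation[OF this]
    show "\<forall>n\<ge>1. ideal_comp m r (ideal_pow m r I n) (\<lambda>i. n * d i) =
            ideal_comp m r (saturation m r (ideal_pow m r I n)) (\<lambda>i. n * d i)"
      by (intro allI impI equalityI sub subsetI birational_imp_saturated[OF f I inj bir])
  next
    assume "\<forall>n\<ge>1. ideal_comp m r (ideal_pow m r I n) (\<lambda>i. n * d i) =
            ideal_comp m r (saturation m r (ideal_pow m r I n)) (\<lambda>i. n * d i)"
    then show "birational m r 1 (\<lambda>_. \<delta>) (to_proj f)"
      by (intro saturated_imp_birational[OF f assms(2) I inj assms(4,5)]) auto
  qed
qed

end
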